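(* Let $\mathcal{P}\subseteq 2^\omega$ be a nonempty additively homogeneous $\Pi^0_1$ class and suppose that the limiting relative measure $\lambda_{\mathcal{P}}(\sigma)$ is defined for all $\sigma\in T_{\mathcal{P}}$. Then for $X\in\mathcal{P}$, the following are equivalent: (a) $X$ is a randomly produced path through $T_{\mathcal{P}}$; (b) $X$ is $T_{\mathcal{P}}$-incompressible; (c) $X$ is globally random in $\mathcal{P}$.
   Context: Notation: $2^\omega$ is the set of infinite binary sequences, $2^{<\omega}$ the set of finite binary strings, $|\sigma|$ the length of $\sigma$, $X\upharpoonright n$ (or $\sigma\upharpoonright n$) the initial segment of length $n$, $[\![\sigma]\!]=\{X\in2^\omega:\sigma\prec X\}$, and $[\![S]\!]=\bigcup_{\sigma\in S}[\![\sigma]\!]$ for $S\subseteq 2^{<\omega}$. $\lambda$ is the Lebesgue measure on $2^\omega$. For nonempty $\sigma$, $\sigma^{\curvearrowright}$ is the string obtained by flipping the last bit of $\sigma$. A $\Pi^0_1$ class is the set of infinite paths through a computable tree $T\subseteq 2^{<\omega}$. For a closed set $\mathcal{P}$, $T_{\mathcal{P}}=\{\sigma:\mathcal{P}\cap[\![\sigma]\!]\neq\emptyset\}$ and $T_{\mathcal{P}}\upharpoonright n=T_{\mathcal{P}}\cap\{0,1\}^n$. $K^A$ is prefix-free Kolmogorov complexity relative to the oracle $A$; $\log=\log_2$. Additive homogeneity: let $\theta_{\mathcal{P}}(\sigma)=\#\{n:1\le n\le|\sigma|\ \&\ (\sigma\upharpoonright n)^{\curvearrowright}\in T_{\mathcal{P}}\}$.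 $\mathcal{P}$ is additively homogeneous if there is $c\in\omega$ such that $|\theta_{\mathcal{P}}(\sigma)-\theta_{\mathcal{P}}(\tau)|\le c$ for all $n$ and all $\sigma,\tau\in T_{\mathcal{P}}\upharpoonright n$. Martin-Löf randomness: for an oracle $A$ and a probability measure $\mu$ on $2^\omega$, $\mathsf{MLR}^A_\mu$ is the set of $X$ such that $X\notin\bigcap_n\mathcal{U}_n$ for every uniformly $A$-c.e. sequence of open sets $(\mathcal{U}_n)$ with $\mu(\mathcal{U}_n)\le2^{-n}$ for all $n$; $\mathsf{MLR}^A=\mathsf{MLR}^A_\lambda$. Randomly produced paths: for $R\in2^\omega$, $\Psi_{\mathcal{P}}(R)\in\mathcal{P}$ is the sequence $X$ built recursively as follows. Given $\sigma=X\upharpoonright m\in T_{\mathcal{P}}$, let $n$ be the number of bits of $R$ used so far, i.e. the number of $j<m$ such that both one-bit extensions of $X\upharpoonright j$ lie in $T_{\mathcal{P}}$. If only one $i\in\{0,1\}$ satisfies $\sigma i\in T_{\mathcal{P}}$, put $X(m)=i$; if both $\sigma0,\sigma1\in T_{\mathcal{P}}$, put $X(m)=R(n)$. The randomly produced paths through $T_{\mathcal{P}}$ are the members of $\{\Psi_{\mathcal{P}}(R):R\in\mathsf{MLR}^{T_{\mathcal{P}}}\}$. Incompressibility: $X\in\mathcal{P}$ is $T_{\mathcal{P}}$-incompressible if there is $c$ such that $K^{T_{\mathcal{P}}}(X\upharpoonright n)\ge\log\#(T_{\mathcal{P}}\upharpoonright n)-c$ for all $n$. Global randomness: the limiting relative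 measure is $\lambda_{\mathcal{P}}(\sigma)=\lim_{n\to\infty}\dfrac{\lambda([\![\sigma]\!]\cap[\![T_{\mathcal{P}}\upharpoonright n]\!])}{\lambda([\![T_{\mathcal{P}}\upharpoonright n]\!])}$, when the limit exists (it is $0$ for $\sigma\notin T_{\mathcal{P}}$). When it is defined for all $\sigma$, it determines a probability measure on $2^\omega$, and $X$ is globally random in $\mathcal{P}$ if $X\in\mathsf{MLR}^{T_{\mathcal{P}}}_{\lambda_{\mathcal{P}}}$. *)

theory Defs
  imports "HOL-Probability.Probability" "HOL-Library.Nat_Bijection" "HOL-Library.Sublist"
begin

type_synonym str = "bool list"
type_synonym cantor = "nat \<Rightarrow> bool"

definition initial :: "cantor \<Rightarrow> nat \<Rightarrow> str" where
  "initial X n = map X [0..<n]"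

definition cylinder :: "str \<Rightarrow> cantor set" where
  "cylinder \<sigma> = {X. initial X (length \<sigma>) = \<sigma>}"

definition open_of :: "str set \<Rightarrow> cantor set" where
  "open_of S = (\<Union>\<sigma>\<in>S. cylinder \<sigma>)"

definition cantor_lebesgue :: "cantor measure" where
  "cantor_lebesgue = PiM UNIV (\<lambda>_. measure_pmf (bernoulli_pmf (1/2)))"

definition flip_last :: "str \<Rightarrow> str" where
  "flip_last \<sigma> = butlast \<sigma> @ [\<not> last \<sigma>]"

text \<open>
  The partial functions on the natural numbers that are computable with oracle \<open>A\<close>. All functions
  are unary; several arguments are passed through the Cantor pairing function \<^const>\<open>prod_encode\<close>.
  The last two rules are primitive recursion (with parameter) and unbounded search; a search
  diverges if an undefined value is met before the first zero.
\<close>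

inductive partrec :: "nat set \<Rightarrow> (nat \<rightharpoonup> nat) \<Rightarrow> bool" for A :: "nat set" where
  zero: "partrec A (\<lambda>_. Some 0)"
| succ: "partrec A (\<lambda>n. Some (Suc n))"
| left: "partrec A (\<lambda>n. Some (fst (prod_decode n)))"
| right: "partrec A (\<lambda>n. Some (snd (prod_decode n)))"
| oracle_query: "partrec A (\<lambda>n. Some (if n \<in> A then 1 else 0))"
| pair: "partrec A f \<Longrightarrow> partrec A g \<Longrightarrow>
    partrec A (\<lambda>n. Option.bind (f n) (\<lambda>a. Option.bind (g n) (\<lambda>b. Some (prod_encode (a, b)))))"
| comp: "partrec A f \<Longrightarrow> partrec A g \<Longrightarrow> partrec A (\<lambda>n. Option.bind (g n) f)"
| prec: "partrec A f \<Longrightarrow> partrec A g \<Longrightarrow>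
    partrec A (\<lambda>n. rec_nat (f (fst (prod_decode n)))
      (\<lambda>k r. Option.bind r (\<lambda>v. g (prod_encode (fst (prod_decode n), prod_encode (k, v)))))
      (snd (prod_decode n)))"
| search: "partrec A f \<Longrightarrow>
    partrec A (\<lambda>a. if \<exists>n. f (prod_encode (a, n)) = Some 0 \<and> (\<forall>m<n. f (prod_encode (a, m)) \<noteq> None)
      then Some (LEAST n. f (prod_encode (a, n)) = Some 0) else None)"

definition computable_in :: "nat set \<Rightarrow> nat set \<Rightarrow> bool" where
  "computable_in A S \<longleftrightarrow> partrec A (\<lambda>n. Some (if n \<in> S then 1 else 0))"

definition ce_in :: "nat set \<Rightarrow> nat set \<Rightarrow> bool" where
  "ce_in A S \<longleftrightarrow> (\<exists>f. partrec A f \<and> S = dom f)"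

text \<open>The bijection from strings to natural numbers given by the length-lexicographic order.\<close>

definition string_code :: "str \<Rightarrow> nat" where
  "string_code \<sigma> = foldl (\<lambda>n b. 2 * n + (if b then 2 else 1)) 0 \<sigma>"

definition is_tree :: "str set \<Rightarrow> bool" where
  "is_tree T \<longleftrightarrow> (\<forall>\<sigma> \<tau>. \<tau> \<in> T \<longrightarrow> prefix \<sigma> \<tau> \<longrightarrow> \<sigma> \<in> T)"

definition paths :: "str set \<Rightarrow> cantor set" where
  "paths T = {X. \<forall>n. initial X n \<in> T}"

definition Pi01_class :: "cantor set \<Rightarrow> bool" where
  "Pi01_class P \<longleftrightarrow> (\<exists>T. is_tree T \<and> computable_in {} (string_code ` T) \<and> P = paths T)"

definition tree_of :: "cantor set \<Rightarrow> str set" where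
  "tree_of P = {\<sigma>. P \<inter> cylinder \<sigma> \<noteq> {}}"

definition level :: "cantor set \<Rightarrow> nat \<Rightarrow> str set" where
  "level P n = {\<sigma> \<in> tree_of P. length \<sigma> = n}"

abbreviation tree_oracle :: "cantor set \<Rightarrow> nat set" where
  "tree_oracle P \<equiv> string_code ` tree_of P"

definition theta :: "cantor set \<Rightarrow> str \<Rightarrow> nat" where
  "theta P \<sigma> = card {n. 1 \<le> n \<and> n \<le> length \<sigma> \<and> flip_last (take n \<sigma>) \<in> tree_of P}"

definition additively_homogeneous :: "cantor set \<Rightarrow> bool" where
  "additively_homogeneous P \<longleftrightarrow>
    (\<exists>c::nat. \<forall>n. \<forall>\<sigma>\<in>level P n. \<forall>\<tau>\<in>level P n. \<bar>int (theta P \<sigma>) - int (theta P \<tau>)\<bar> \<le> int c)"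

definition uniformly_ce_open :: "nat set \<Rightarrow> (nat \<Rightarrow> cantor set) \<Rightarrow> bool" where
  "uniformly_ce_open A \<U> \<longleftrightarrow>
    (\<exists>S :: nat \<Rightarrow> str set. ce_in A {prod_encode (n, string_code \<sigma>) | n \<sigma>. \<sigma> \<in> S n} \<and>
      (\<forall>n. \<U> n = open_of (S n)))"

definition MLR :: "nat set \<Rightarrow> cantor measure \<Rightarrow> cantor set" where
  "MLR A \<mu> = {X. \<forall>\<U>. uniformly_ce_open A \<U> \<longrightarrow> (\<forall>n. emeasure \<mu> (\<U> n) \<le> ennreal ((1/2) ^ n)) \<longrightarrow>
    X \<notin> (\<Inter>n. \<U> n)}"

definition branching :: "cantor set \<Rightarrow> str \<Rightarrow> bool" where
  "branching P \<sigma> \<longleftrightarrow> \<sigma> @ [False] \<in> tree_of P \<and> \<sigma> @ [True] \<in> tree_of P"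

primrec Psi_initial :: "cantor set \<Rightarrow> cantor \<Rightarrow> nat \<Rightarrow> str" where
  "Psi_initial P R 0 = []"
| "Psi_initial P R (Suc m) =
    (let \<sigma> = Psi_initial P R m; n = card {j. j < m \<and> branching P (take j \<sigma>)}
     in \<sigma> @ [if branching P \<sigma> then R n else (THE i. \<sigma> @ [i] \<in> tree_of P)])"

definition Psi :: "cantor set \<Rightarrow> cantor \<Rightarrow> cantor" where
  "Psi P R m = last (Psi_initial P R (Suc m))"

definition randomly_produced :: "cantor set \<Rightarrow> cantor \<Rightarrow> bool" where
  "randomly_produced P X \<longleftrightarrow> X \<in> Psi P ` MLR (tree_oracle P) cantor_lebesgue"

definition prefix_free_machine :: "nat set \<Rightarrow> (str \<rightharpoonup> str) \<Rightarrow> bool" where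
  "prefix_free_machine A M \<longleftrightarrow>
    (\<exists>f. partrec A f \<and> (\<forall>\<sigma>. f (string_code \<sigma>) = map_option string_code (M \<sigma>))) \<and>
    (\<forall>\<sigma>\<in>dom M. \<forall>\<tau>\<in>dom M. prefix \<sigma> \<tau> \<longrightarrow> \<sigma> = \<tau>)"

text \<open>The value is \<open>\<infinity>\<close> for strings outside the range of the machine.\<close>

definition machine_complexity :: "(str \<rightharpoonup> str) \<Rightarrow> str \<Rightarrow> enat" where
  "machine_complexity M \<sigma> = (INF \<tau>\<in>{\<tau>. M \<tau> = Some \<sigma>}. enat (length \<tau>))"

text \<open>
  Prefix-free complexity relative to \<open>A\<close> is \<^term>\<open>machine_complexity U\<close> for a fixed optimal
  prefix-free machine \<open>U\<close> with oracle \<open>A\<close>; it depends on \<open>U\<close> only up to an additive constant.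
\<close>

definition optimal_prefix_free_machine :: "nat set \<Rightarrow> (str \<rightharpoonup> str) \<Rightarrow> bool" where
  "optimal_prefix_free_machine A U \<longleftrightarrow> prefix_free_machine A U \<and>
    (\<forall>M. prefix_free_machine A M \<longrightarrow>
      (\<exists>d::nat. \<forall>\<sigma>. machine_complexity U \<sigma> \<le> machine_complexity M \<sigma> + enat d))"

text \<open>To be used with \<open>U\<close> optimal for the oracle \<^term>\<open>tree_oracle P\<close>.\<close>

definition incompressible :: "(str \<rightharpoonup> str) \<Rightarrow> cantor set \<Rightarrow> cantor \<Rightarrow> bool" where
  "incompressible U P X \<longleftrightarrow>
    (\<exists>c::real. \<forall>n. ereal_of_enat (machine_complexity U (initial X n))
      \<ge> ereal (log 2 (real (card (level P n))) - c))"

definition relative_measure :: "cantor set \<Rightarrow> str \<Rightarrow> nat \<Rightarrow> real" where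
  "relative_measure P \<sigma> n =
    measure cantor_lebesgue (cylinder \<sigma> \<inter> open_of (level P n)) /
    measure cantor_lebesgue (open_of (level P n))"

definition limiting_relative_measure :: "cantor set \<Rightarrow> str \<Rightarrow> real" where
  "limiting_relative_measure P \<sigma> = lim (relative_measure P \<sigma>)"

text \<open>
  The Borel measure whose value on each cylinder is the limiting relative measure. If the limits
  exist for all strings in the tree, they exist for all strings: off the tree the ratios are
  eventually 0.
\<close>

definition limiting_measure :: "cantor set \<Rightarrow> cantor measure" where
  "limiting_measure P =
    extend_measure UNIV UNIV cylinder (\<lambda>\<sigma>. ennreal (limiting_relative_measure P \<sigma>))"

definition globally_random :: "cantor set \<Rightarrow> cantor \<Rightarrow> bool" where
  "globally_random P X \<longleftrightarrow> X \<in> MLR (tree_oracle P) (limiting_measure P)"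

end

theory Submission
  imports Defs
begin

text \<open>
  Let \<open>b(\<sigma>)\<close> be the number of branching nodes below \<open>\<sigma>\<close>, which is \<open>\<theta>(\<sigma>)\<close> on the tree, and let
  \<open>\<rho>(\<sigma>)\<close> be the string of the \<open>b(\<sigma>)\<close> bits of \<open>\<sigma>\<close> read at them (\<open>branch_bits\<close>). A sequence \<open>R\<close> produces
  a path through \<open>\<sigma>\<close> iff \<open>R\<close> extends \<open>\<rho>(\<sigma>)\<close>, so the weights \<open>2\<^sup>-\<^sup>b\<^sup>(\<^sup>\<sigma>\<^sup>)\<close> add up to 1 on each level; by
  homogeneity each of them is, up to a factor \<open>2\<^sup>c\<close>, the reciprocal of the size of the level. Hence
  the limiting relative measure of \<open>\<sigma>\<close> is \<open>2\<^sup>-\<^sup>b\<^sup>(\<^sup>\<sigma>\<^sup>)\<close> up to the same factor. Tests for it and for the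
  Lebesgue measure are therefore carried into each other along \<open>\<rho>\<close>, and incompressibility of \<open>X\<close> says
  that \<open>K(X \<restriction> n) \<ge> b(X \<restriction> n) - O(1)\<close>, which is the Levin-Schnorr characterization of randomness
  for this measure.
\<close>

subsection \<open>Computability relative to an oracle\<close>

text \<open>The map from \<open>R\<close> to the path cannot simply be inverted: when
  \<open>X\<close> meets only finitely many branching nodes, the bits of \<open>R\<close> beyond a
  finite string leave no trace in \<open>X\<close>, and a random continuation has to be supplied. It
  exists because countably many tests each capture a null set. In the other direction
  \<open>\<rho>\<close> is not injective, since a string and its extension by forced bits have the
  same image, so covers are carried over by choosing preimages. The passage from incompressibility
  to randomness needs more than a transfer: all components of a test must be served by one
  prefix-free machine, whence the Kraft-Chaitin theorem, whose requests have to be decidable and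
  disjoint within a component. Since \<open>MLR\<close> refers to all tests and optimality to all
  machines, no universal test or machine is constructed; computable stage approximations are enough
  to convert enumerations. Finally, the limits on cylinders are the values of
  \<open>limiting_measure P\<close> only once some measure with these values has been
  exhibited.\<close>

definition pfst :: "nat \<Rightarrow> nat" where "pfst n = fst (prod_decode n)"
definition psnd :: "nat \<Rightarrow> nat" where "psnd n = snd (prod_decode n)"

lemma pfst_encode [simp]: "pfst (prod_encode (a, b)) = a"
  by (simp add: pfst_def)

lemma psnd_encode [simp]: "psnd (prod_encode (a, b)) = b"
  by (simp add: psnd_def)

lemma prod_encode_pfst_psnd [simp]: "prod_encode (pfst n, psnd n) = n"
  by (simp add: pfst_def psnd_def)

text \<open>Total functions are separated out because their closure rules compose without
  \<open>Option.bind\<close>; the rules in \<open>rec_intros\<close> then follow the shape of the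
  term.\<close>

definition recf :: "nat set \<Rightarrow> (nat \<Rightarrow> nat) \<Rightarrow> bool" where
  "recf A f \<longleftrightarrow> partrec A (\<lambda>n. Some (f n))"

definition recp :: "nat set \<Rightarrow> (nat \<Rightarrow> bool) \<Rightarrow> bool" where
  "recp A p \<longleftrightarrow> recf A (\<lambda>n. if p n then 1 else 0)"

section \<open>Closure properties of total computable functions and decidable predicates\<close>

named_theorems rec_intros

lemma recf_comp: "recf A f \<Longrightarrow> recf A g \<Longrightarrow> recf A (\<lambda>x. f (g x))"
  unfolding recf_def using partrec.comp[of A "\<lambda>n. Some (f n)" "\<lambda>n. Some (g n)"] by simp

lemma recf_pair [rec_intros]:
  "recf A f \<Longrightarrow> recf A g \<Longrightarrow> recf A (\<lambda>x. prod_encode (f x, g x))"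
  unfolding recf_def using partrec.pair[of A "\<lambda>n. Some (f n)" "\<lambda>n. Some (g n)"] by simp

lemma recf_pfst [rec_intros]: "recf A f \<Longrightarrow> recf A (\<lambda>x. pfst (f x))"
  using recf_comp[of A pfst f] partrec.left[of A] by (simp add: recf_def pfst_def)

lemma recf_psnd [rec_intros]: "recf A f \<Longrightarrow> recf A (\<lambda>x. psnd (f x))"
  using recf_comp[of A psnd f] partrec.right[of A] by (simp add: recf_def psnd_def)

lemma recf_Suc [rec_intros]: "recf A f \<Longrightarrow> recf A (\<lambda>x. Suc (f x))"
  using recf_comp[of A Suc f] partrec.succ[of A] by (simp add: recf_def)

lemma recf_const [rec_intros]: "recf A (\<lambda>_. k)"
proof (induction k)
  case 0
  then show ?case using partrec.zero by (simp add: recf_def)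
qed (rule recf_Suc)

lemma recf_id [rec_intros]: "recf A (\<lambda>x. x)"
proof -
  have "recf A pfst" "recf A psnd"
    using partrec.left[of A] partrec.right[of A] by (simp_all add: recf_def pfst_def psnd_def)
  from recf_pair[OF this] show ?thesis by simp
qed

text \<open>A curried function counts as computable through its form on pairs; the shape
  \<open>g (pfst e) (psnd e)\<close> is the convention for several arguments throughout.\<close>

lemma recf_binary:
  assumes "recf A (\<lambda>e. g (pfst e) (psnd e))" "recf A f1" "recf A f2"
  shows "recf A (\<lambda>x. g (f1 x) (f2 x))"
  using recf_comp[OF assms(1) recf_pair[OF assms(2,3)]] by simp

text \<open>The whole input \<open>x\<close> is the parameter of the recursion, so that base, step
  and depth may all depend on it: \<open>prec\<close> is run on the pair of \<open>x\<close> and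
  \<open>n x\<close>.\<close>

lemma recf_rec [rec_intros]:
  assumes "recf A f" "recf A (\<lambda>e. g (pfst e) (pfst (psnd e)) (psnd (psnd e)))" "recf A n"
  shows "recf A (\<lambda>x. rec_nat (f x) (g x) (n x))"
proof -
  let ?g = "\<lambda>e. g (pfst e) (pfst (psnd e)) (psnd (psnd e))"
  have eq: "rec_nat (Some (f a)) (\<lambda>k r. Option.bind r (\<lambda>v. Some (?g (prod_encode (a, prod_encode (k, v)))))) m
      = Some (rec_nat (f a) (g a) m)" for a m
    by (induction m) simp_all
  have "recf A (\<lambda>e. rec_nat (f (pfst e)) (g (pfst e)) (psnd e))"
    using partrec.prec[of A "\<lambda>n. Some (f n)" "\<lambda>e. Some (?g e)"] assms(1,2) eq
    by (simp add: recf_def pfst_def[symmetric] psnd_def[symmetric])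
  from recf_comp[OF this recf_pair[OF recf_id assms(3)]] show ?thesis by simp
qed

lemma recf_add [rec_intros]: "recf A f \<Longrightarrow> recf A g \<Longrightarrow> recf A (\<lambda>x. f x + g x)"
proof -
  have eq: "a + b = rec_nat a (\<lambda>k v. Suc v) b" for a b :: nat by (induction b) auto
  show "recf A f \<Longrightarrow> recf A g \<Longrightarrow> recf A (\<lambda>x. f x + g x)"
    unfolding eq by (intro rec_intros)
qed

lemma recf_mult [rec_intros]: "recf A f \<Longrightarrow> recf A g \<Longrightarrow> recf A (\<lambda>x. f x * g x)"
proof -
  have eq: "a * b = rec_nat 0 (\<lambda>k v. v + a) b" for a b :: nat by (induction b) auto
  assume f: "recf A f" and g: "recf A g"
  show "recf A (\<lambda>x. f x * g x)"
    unfolding eq by (intro rec_intros f g recf_comp[OF f])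
qed

lemma recf_power [rec_intros]: "recf A f \<Longrightarrow> recf A g \<Longrightarrow> recf A (\<lambda>x. f x ^ g x)"
proof -
  have eq: "a ^ b = rec_nat 1 (\<lambda>k v. v * a) b" for a b :: nat by (induction b) auto
  assume f: "recf A f" and g: "recf A g"
  show "recf A (\<lambda>x. f x ^ g x)"
    unfolding eq by (intro rec_intros f g recf_comp[OF f])
qed

lemma recf_pred [rec_intros]: "recf A f \<Longrightarrow> recf A (\<lambda>x. f x - Suc 0)"
proof -
  have eq: "a - Suc 0 = rec_nat 0 (\<lambda>k v. k) a" for a :: nat by (induction a) auto
  show "recf A f \<Longrightarrow> recf A (\<lambda>x. f x - Suc 0)"
    unfolding eq by (intro rec_intros)
qed

lemma recf_diff [rec_intros]:
  assumes "recf A f" "recf A g"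
  shows "recf A (\<lambda>x. f x - g x)"
proof -
  have eq: "rec_nat a (\<lambda>k v. v - Suc 0) b = a - b" for a b :: nat by (induction b) auto
  have "recf A (\<lambda>x. rec_nat (f x) (\<lambda>k v. v - Suc 0) (g x))"
    by (intro rec_intros assms)
  then show ?thesis by (simp only: eq)
qed

lemma recf_if [rec_intros]:
  "recp A p \<Longrightarrow> recf A f \<Longrightarrow> recf A g \<Longrightarrow> recf A (\<lambda>x. if p x then f x else g x)"
proof -
  assume "recp A p" and fg: "recf A f" "recf A g"
  then have p: "recf A (\<lambda>x. if p x then 1 else 0)" by (simp add: recp_def)
  have eq: "(if p x then f x else g x)
      = (if p x then 1 else 0) * f x + (1 - (if p x then 1 else 0)) * g x" for x
    by simp
  show ?thesis unfolding eq by (intro rec_intros p fg)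
qed

lemma recp_le [rec_intros]: "recf A f \<Longrightarrow> recf A g \<Longrightarrow> recp A (\<lambda>x. f x \<le> g x)"
proof -
  have eq: "(if a \<le> b then 1 else 0) = 1 - (a - b)" for a b :: nat by simp
  show "recf A f \<Longrightarrow> recf A g \<Longrightarrow> recp A (\<lambda>x. f x \<le> g x)"
    unfolding recp_def eq by (intro rec_intros)
qed

lemma recp_not [rec_intros]: "recp A p \<Longrightarrow> recp A (\<lambda>x. \<not> p x)"
proof -
  have eq: "(if \<not> b then 1 else 0) = 1 - (if b then 1 else 0 :: nat)" for b by simp
  show "recp A p \<Longrightarrow> recp A (\<lambda>x. \<not> p x)"
    unfolding recp_def eq by (rule recf_diff[OF recf_const])
qed

lemma recp_conj [rec_intros]: "recp A p \<Longrightarrow> recp A q \<Longrightarrow> recp A (\<lambda>x. p x \<and> q x)"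
proof -
  have eq: "(if b \<and> c then 1 else 0) = (if b then 1 else 0 :: nat) * (if c then 1 else 0)" for b c
    by simp
  show "recp A p \<Longrightarrow> recp A q \<Longrightarrow> recp A (\<lambda>x. p x \<and> q x)"
    unfolding recp_def eq by (rule recf_mult)
qed

lemma recp_disj [rec_intros]: "recp A p \<Longrightarrow> recp A q \<Longrightarrow> recp A (\<lambda>x. p x \<or> q x)"
  using recp_not[OF recp_conj[OF recp_not recp_not], of A p q] by simp

lemma recp_less [rec_intros]: "recf A f \<Longrightarrow> recf A g \<Longrightarrow> recp A (\<lambda>x. f x < g x)"
  using recp_le[OF recf_Suc, of A f g] by (simp add: Suc_le_eq)

lemma recp_eq [rec_intros]: "recf A f \<Longrightarrow> recf A g \<Longrightarrow> recp A (\<lambda>x. f x = g x)"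
  using recp_conj[OF recp_le recp_le, of A f g g f] by (simp add: order_eq_iff)

lemma recp_comp: "recp A p \<Longrightarrow> recf A g \<Longrightarrow> recp A (\<lambda>x. p (g x))"
  unfolding recp_def by (rule recf_comp)

lemma recp_oracle [rec_intros]: "recf A f \<Longrightarrow> recp A (\<lambda>x. f x \<in> A)"
  using recp_comp[of A "\<lambda>n. n \<in> A" f] partrec.oracle_query[of A]
  by (simp add: recp_def recf_def)

lemma recp_bex [rec_intros]:
  assumes "recp A (\<lambda>e. p (pfst e) (psnd e))" "recf A n"
  shows "recp A (\<lambda>x. \<exists>k<n x. p x k)"
proof -
  have eq: "rec_nat 0 (\<lambda>k v. if p x k then 1 else v) m = (if \<exists>k<m. p x k then 1 else 0)" for x m
    by (induction m) (auto simp: less_Suc_eq)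
  \<comment> \<open>Inside the recursion \<open>e\<close> codes \<open>(x, (k, v))\<close>; the
    predicate needs only the pair \<open>(x, k)\<close>.\<close>
  have "recf A (\<lambda>e. prod_encode (pfst e, pfst (psnd e)))" by (intro rec_intros)
  from recp_comp[OF assms(1) this] have p: "recp A (\<lambda>e. p (pfst e) (pfst (psnd e)))" by simp
  show ?thesis unfolding recp_def eq[symmetric] by (intro rec_intros assms p)
qed

lemma recp_ball [rec_intros]:
  assumes "recp A (\<lambda>e. p (pfst e) (psnd e))" "recf A n"
  shows "recp A (\<lambda>x. \<forall>k<n x. p x k)"
  using recp_not[OF recp_bex[OF recp_not], OF assms] by simp

lemma recf_sum [rec_intros]:
  assumes "recf A (\<lambda>e. f (pfst e) (psnd e))" "recf A n"
  shows "recf A (\<lambda>x. \<Sum>k<n x. f x k)"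
proof -
  have eq: "(\<Sum>k<m. f x k) = rec_nat 0 (\<lambda>k v. v + f x k) m" for x m
    by (induction m) auto
  have "recf A (\<lambda>e. prod_encode (pfst e, pfst (psnd e)))" by (intro rec_intros)
  from recf_comp[OF assms(1) this] have f: "recf A (\<lambda>e. f (pfst e) (pfst (psnd e)))" by simp
  show ?thesis unfolding eq by (intro rec_intros assms f)
qed

lemma recf_funpow [rec_intros]:
  assumes "recf A (\<lambda>e. g (pfst e) (psnd e))" "recf A n" "recf A f"
  shows "recf A (\<lambda>x. (g x ^^ n x) (f x))"
proof -
  have eq: "(g x ^^ m) a = rec_nat a (\<lambda>k. g x) m" for x m a
    by (induction m) auto
  have "recf A (\<lambda>e. prod_encode (pfst e, psnd (psnd e)))" by (intro rec_intros)
  from recf_comp[OF assms(1) this] have g: "recf A (\<lambda>e. g (pfst e) (psnd (psnd e)))" by simp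
  show ?thesis unfolding eq by (intro rec_intros assms g)
qed

text \<open>The characteristic function of a decidable predicate is total, so the search never meets
  an undefined value and diverges only if there is no witness.\<close>

lemma partrec_Least:
  assumes "recp A (\<lambda>e. p (pfst e) (psnd e))"
  shows "partrec A (\<lambda>x. if \<exists>n. p x n then Some (LEAST n. p x n) else None)"
proof -
  have "recf A (\<lambda>e. if p (pfst e) (psnd e) then 0 else 1)"
    by (intro rec_intros assms)
  note search = partrec.search[OF this[unfolded recf_def]]
  have "(if b then 0 else 1) = (0 :: nat) \<longleftrightarrow> b" for b by simp
  with search show ?thesis by (simp only: pfst_encode psnd_encode option.inject option.simps) simp
qed

lemma recf_Least [rec_intros]:
  assumes "recp A (\<lambda>e. p (pfst e) (psnd e))" "\<And>x. \<exists>n. p x n"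
  shows "recf A (\<lambda>x. LEAST n. p x n)"
  using partrec_Least[OF assms(1)] assms(2) by (simp add: recf_def)

text \<open>A stage approximation: \<open>F x s\<close> is \<open>0\<close> as long as no value has
  appeared by stage \<open>s\<close>, and \<open>Suc v\<close> once the value \<open>v\<close> has.
  The shift by one lets a total function on numbers carry the option type.\<close>

definition staged :: "(nat \<rightharpoonup> nat) \<Rightarrow> (nat \<Rightarrow> nat \<Rightarrow> nat) \<Rightarrow> bool" where
  "staged f F \<longleftrightarrow> (\<forall>x s t v. F x s = Suc v \<longrightarrow> s \<le> t \<longrightarrow> F x t = Suc v) \<and>
     (\<forall>x v. f x = Some v \<longleftrightarrow> (\<exists>s. F x s = Suc v))"

lemma staged_mono: "staged f F \<Longrightarrow> F x s = Suc v \<Longrightarrow> s \<le> t \<Longrightarrow> F x t = Suc v"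
  unfolding staged_def by blast

lemma staged_Some: "staged f F \<Longrightarrow> f x = Some v \<longleftrightarrow> (\<exists>s. F x s = Suc v)"
  unfolding staged_def by blast

lemma staged_Some_large: "staged f F \<Longrightarrow> f x = Some v \<Longrightarrow> \<exists>s. \<forall>t\<ge>s. F x t = Suc v"
  by (metis staged_Some staged_mono)

lemma staged_total: "staged (\<lambda>n. Some (f n)) (\<lambda>x s. Suc (f x))"
  unfolding staged_def by auto

lemma staged_bind:
  assumes f: "staged f F" and g: "\<And>a. staged (g a) (G a)"
  shows "staged (\<lambda>x. Option.bind (f x) (\<lambda>a. g a x)) (\<lambda>x s. if F x s = 0 then 0 else G (F x s - 1) x s)"
  unfolding staged_def
proof (intro conjI allI impI iffI)
  fix x s t v assume *: "(if F x s = 0 then 0 else G (F x s - 1) x s) = Suc v" and "s \<le> t"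
  then obtain a where a: "F x s = Suc a" "G a x s = Suc v" by (cases "F x s") auto
  show "(if F x t = 0 then 0 else G (F x t - 1) x t) = Suc v"
    using staged_mono[OF f a(1) \<open>s \<le> t\<close>] staged_mono[OF g a(2) \<open>s \<le> t\<close>] by simp
next
  fix x v assume "Option.bind (f x) (\<lambda>a. g a x) = Some v"
  then obtain a where a: "f x = Some a" "g a x = Some v" by (cases "f x") auto
  obtain s t where "\<forall>r\<ge>s. F x r = Suc a" "\<forall>r\<ge>t. G a x r = Suc v"
    using staged_Some_large[OF f a(1)] staged_Some_large[OF g a(2)] by auto
  then have "F x (max s t) = Suc a" "G a x (max s t) = Suc v" by auto
  then show "\<exists>s. (if F x s = 0 then 0 else G (F x s - 1) x s) = Suc v"
    by (intro exI[of _ "max s t"]) simp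
next
  fix x v assume "\<exists>s. (if F x s = 0 then 0 else G (F x s - 1) x s) = Suc v"
  then obtain s where "(if F x s = 0 then 0 else G (F x s - 1) x s) = Suc v" by blast
  then obtain a where "F x s = Suc a" "G a x s = Suc v" by (cases "F x s") auto
  then have "f x = Some a" "g a x = Some v"
    using staged_Some[OF f] staged_Some[OF g] by blast+
  then show "Option.bind (f x) (\<lambda>a. g a x) = Some v" by simp
qed

lemma staged_subst: "staged f F \<Longrightarrow> staged (\<lambda>x. f (h x)) (\<lambda>x. F (h x))"
  unfolding staged_def by blast

text \<open>Unrolled, a recursion of depth \<open>m\<close> is an \<open>m\<close>-fold
  \<open>Option.bind\<close>, so each step is an instance of \<open>staged_bind\<close>.\<close>

lemma staged_rec:
  assumes f: "staged f F" and g: "staged g G"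
  shows "staged (\<lambda>x. rec_nat (f x) (\<lambda>k r. Option.bind r (\<lambda>v. g (prod_encode (x, prod_encode (k, v))))) m)
    (\<lambda>x s. rec_nat (F x s) (\<lambda>k r. if r = 0 then 0 else G (prod_encode (x, prod_encode (k, r - 1))) s) m)"
proof (induction m)
  case (Suc m)
  show ?case
    using staged_bind[OF Suc, of "\<lambda>v x. g (prod_encode (x, prod_encode (m, v)))"
        "\<lambda>v x. G (prod_encode (x, prod_encode (m, v)))"] staged_subst[OF g]
    by simp
qed (simp add: f)

text \<open>At stage \<open>s\<close> only witnesses below \<open>s\<close> are tried.
  \<open>C a s n\<close> says that by stage \<open>s\<close> the value zero has been seen at
  \<open>n\<close> and a positive value at every smaller argument; such an \<open>n\<close> is
  unique and persists at later stages. The disjunct \<open>n = s\<close> only makes the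
  \<open>LEAST\<close> total, as \<open>recf_Least\<close> demands: it cannot win when a witness
  below \<open>s\<close> exists.\<close>

lemma staged_search:
  assumes f: "staged f F"
  defines "C \<equiv> \<lambda>a s n. F (prod_encode (a, n)) s = 1 \<and> (\<forall>m<n. 1 < F (prod_encode (a, m)) s)"
  shows "staged (\<lambda>a. if \<exists>n. f (prod_encode (a, n)) = Some 0 \<and> (\<forall>m<n. f (prod_encode (a, m)) \<noteq> None)
      then Some (LEAST n. f (prod_encode (a, n)) = Some 0) else None)
    (\<lambda>a s. if \<exists>n<s. C a s n then Suc (LEAST n. C a s n \<or> n = s) else 0)" (is "staged ?f ?F")
proof -
  have uniq: "C a s n \<Longrightarrow> C a s m \<Longrightarrow> n = m" for a s n m
    unfolding C_def by (metis less_irrefl nat_neq_iff)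
  have F: "?F a s = Suc v \<longleftrightarrow> v < s \<and> C a s v" for a s v
  proof (cases "\<exists>n<s. C a s n")
    case True
    then obtain n where n: "n < s" "C a s n" by blast
    have "(LEAST n. C a s n \<or> n = s) = n"
    proof (rule Least_equality)
      show "n \<le> y" if "C a s y \<or> y = s" for y
        using that n(1) uniq[OF n(2), of y] by auto
    qed (use n in simp)
    with True have "?F a s = Suc n" by simp
    moreover have "v < s \<and> C a s v \<longleftrightarrow> v = n" using n uniq[OF n(2), of v] by auto
    ultimately show ?thesis by auto
  qed auto
  have mono: "C a t n" if "C a s n" "s \<le> t" for a s t n
  proof -
    have "F (prod_encode (a, m)) t = F (prod_encode (a, m)) s" if "0 < F (prod_encode (a, m)) s" for m
      using staged_mono[OF f, of "prod_encode (a, m)" s _ t] that \<open>s \<le> t\<close>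
      by (metis Suc_pred)
    note eq = this
    show ?thesis
      unfolding C_def
    proof (intro conjI allI impI)
      show "F (prod_encode (a, n)) t = 1" using that(1) eq[of n] unfolding C_def by simp
      fix m assume "m < n"
      then have "1 < F (prod_encode (a, m)) s" using that(1) unfolding C_def by blast
      with eq[of m] show "1 < F (prod_encode (a, m)) t" by simp
    qed
  qed
  \<comment> \<open>In the rule for \<open>search\<close> the zero that ensures convergence and the
    least zero are separate quantities. Below the former everything is defined, so the latter has
    only positive values below it.\<close>
  have f1: "?f a = Some v \<longleftrightarrow> f (prod_encode (a, v)) = Some 0 \<and> (\<forall>m<v. \<exists>u. f (prod_encode (a, m)) = Some (Suc u))"
    (is "?l \<longleftrightarrow> ?r") for a v
  proof
    assume l: ?l
    let ?P = "\<lambda>n. f (prod_encode (a, n)) = Some 0"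
    from l have ex: "\<exists>n. ?P n \<and> (\<forall>m<n. f (prod_encode (a, m)) \<noteq> None)"
      by (metis option.simps(3))
    with l have v: "v = (LEAST n. ?P n)" by (simp only: if_True simp_thms option.inject)
    from ex obtain n where n: "?P n" "\<forall>m<n. f (prod_encode (a, m)) \<noteq> None" by blast
    have "?P v" "v \<le> n" using n unfolding v by (auto intro: LeastI Least_le)
    moreover have "\<exists>u. f (prod_encode (a, m)) = Some (Suc u)" if "m < v" for m
    proof -
      have "\<not> ?P m" using that not_less_Least v by blast
      moreover have "f (prod_encode (a, m)) \<noteq> None" using n that \<open>v \<le> n\<close> by simp
      then obtain w where "f (prod_encode (a, m)) = Some w" by blast
      ultimately show ?thesis by (cases w) auto
    qed
    ultimately show ?r by auto
  next
    assume r: ?r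
    have "v \<le> y" if "f (prod_encode (a, y)) = Some 0" for y
    proof (rule ccontr)
      assume "\<not> v \<le> y"
      with r obtain u where "f (prod_encode (a, y)) = Some (Suc u)" by (auto simp: not_le)
      with that show False by simp
    qed
    with r have "(LEAST n. f (prod_encode (a, n)) = Some 0) = v"
      by (intro Least_equality) blast+
    moreover have "\<exists>n. f (prod_encode (a, n)) = Some 0 \<and> (\<forall>m<n. f (prod_encode (a, m)) \<noteq> None)"
      using r by (intro exI[of _ v]) auto
    ultimately show ?l by simp
  qed
  show ?thesis
    unfolding staged_def F f1
  proof (intro conjI allI impI iffI; (elim conjE exE)?)
    fix a v assume *: "f (prod_encode (a, v)) = Some 0" "\<forall>m<v. \<exists>u. f (prod_encode (a, m)) = Some (Suc u)"
    have "\<exists>s. \<forall>t\<ge>s. (m = v \<longrightarrow> F (prod_encode (a, m)) t = 1) \<and> (m < v \<longrightarrow> 1 < F (prod_encode (a, m)) t)" for m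
    proof -
      consider "m = v" | "m < v" | "m > v" by linarith
      then show ?thesis
      proof cases
        case 1
        then show ?thesis using staged_Some_large[OF f *(1)] by auto
      next
        case 2
        then obtain u where "f (prod_encode (a, m)) = Some (Suc u)" using * by auto
        from staged_Some_large[OF f this] obtain s where "\<forall>t\<ge>s. F (prod_encode (a, m)) t = Suc (Suc u)"
          by blast
        with 2 show ?thesis by (intro exI[of _ s]) auto
      qed auto
    qed
    then have "\<exists>s. \<forall>m. \<forall>t\<ge>s m. (m = v \<longrightarrow> F (prod_encode (a, m)) t = 1) \<and> (m < v \<longrightarrow> 1 < F (prod_encode (a, m)) t)"
      by (intro choice allI)
    then obtain s where s: "\<And>m t. t \<ge> s m \<Longrightarrow> (m = v \<longrightarrow> F (prod_encode (a, m)) t = 1) \<and> (m < v \<longrightarrow> 1 < F (prod_encode (a, m)) t)"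
      by blast
    \<comment> \<open>A stage beyond the finitely many \<open>s m\<close> with
      \<open>m \<le> v\<close>; the summand \<open>Suc v\<close> puts the witness \<open>v\<close>
      below the stage.\<close>
    define t where "t = Suc v + (\<Sum>m\<le>v. s m)"
    have "s m \<le> t" if "m \<le> v" for m
      using member_le_sum[of m "{..v}" s] that by (auto simp: t_def)
    then have "C a t v" unfolding C_def using s[of _ t] by auto
    then have "v < t \<and> C a t v" by (simp add: t_def)
    then show "\<exists>s. v < s \<and> C a s v" by blast
  next
    fix a v s assume "C a s v"
    then show "f (prod_encode (a, v)) = Some 0"
      unfolding C_def using staged_Some[OF f] by auto
  next
    fix a v s m assume "C a s v" "m < v"
    then show "\<exists>u. f (prod_encode (a, m)) = Some (Suc u)"
      unfolding C_def using staged_Some[OF f, of "prod_encode (a, m)"]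
      by (auto dest!: spec[of _ m] simp: less_iff_Suc_add)
  next
    fix a s t v assume "v < s" "C a s v" "s \<le> t"
    then show "v < t" "C a t v" using mono by auto
  qed
qed

text \<open>This plays the role of Kleene's normal form: each rule of \<open>partrec\<close> is
  matched by a rule for \<open>staged\<close>, and the stage function so obtained is again total and
  computable from \<open>A\<close>.\<close>

lemma partrec_staged:
  "partrec A f \<Longrightarrow> \<exists>F. recf A (\<lambda>e. F (pfst e) (psnd e)) \<and> staged f F"
proof (induction rule: partrec.induct)
  case zero
  show ?case by (rule exI[of _ "\<lambda>x s. Suc 0"]) (intro conjI rec_intros staged_total)
next
  case succ
  show ?case by (rule exI[of _ "\<lambda>x s. Suc (Suc x)"]) (intro conjI rec_intros staged_total)
next
  case left
  show ?case unfolding pfst_def[symmetric]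
    by (rule exI[of _ "\<lambda>x s. Suc (pfst x)"]) (intro conjI rec_intros staged_total)
next
  case right
  show ?case unfolding psnd_def[symmetric]
    by (rule exI[of _ "\<lambda>x s. Suc (psnd x)"]) (intro conjI rec_intros staged_total)
next
  case oracle_query
  show ?case
    by (rule exI[of _ "\<lambda>x s. Suc (if x \<in> A then 1 else 0)"]) (intro conjI rec_intros staged_total)
next
  case (pair f g)
  then obtain F G where F: "recf A (\<lambda>e. F (pfst e) (psnd e))" "staged f F"
    and G: "recf A (\<lambda>e. G (pfst e) (psnd e))" "staged g G" by blast
  let ?G = "\<lambda>a x s. if G x s = 0 then 0 else Suc (prod_encode (a, G x s - 1))"
  have "staged (\<lambda>x. Option.bind (g x) (\<lambda>b. Some (prod_encode (a, b)))) (?G a)" for a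
    using staged_bind[OF G(2), of "\<lambda>b x. Some (prod_encode (a, b))" "\<lambda>b x s. Suc (prod_encode (a, b))"]
      staged_total[of "\<lambda>x. prod_encode (a, _)"] by blast
  note staged_bind[of f F "\<lambda>a x. Option.bind (g x) (\<lambda>b. Some (prod_encode (a, b)))" ?G, OF F(2) this]
  moreover have "recf A (\<lambda>e. if F (pfst e) (psnd e) = 0 then 0 else ?G (F (pfst e) (psnd e) - 1) (pfst e) (psnd e))"
    by (simp only: One_nat_def, intro rec_intros F G)
  ultimately show ?case
    by (intro exI[of _ "\<lambda>x s. if F x s = 0 then 0 else ?G (F x s - 1) x s"] conjI)
next
  case (comp f g)
  then obtain F G where F: "recf A (\<lambda>e. F (pfst e) (psnd e))" "staged f F"
    and G: "recf A (\<lambda>e. G (pfst e) (psnd e))" "staged g G" by blast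
  have "staged (\<lambda>x. f a) (\<lambda>x. F a)" for a
    by (rule staged_subst[OF F(2)])
  note staged_bind[of g G "\<lambda>a x. f a" "\<lambda>a x. F a", OF G(2) this]
  moreover have "recf A (\<lambda>e. if G (pfst e) (psnd e) = 0 then 0 else F (G (pfst e) (psnd e) - 1) (psnd e))"
    by (simp only: One_nat_def, intro rec_intros G recf_binary[OF F(1)])
  ultimately show ?case
    by (intro exI[of _ "\<lambda>x s. if G x s = 0 then 0 else F (G x s - 1) s"] conjI)
next
  case (prec f g)
  then obtain F G where F: "recf A (\<lambda>e. F (pfst e) (psnd e))" "staged f F"
    and G: "recf A (\<lambda>e. G (pfst e) (psnd e))" "staged g G" by blast
  let ?H = "\<lambda>x s. rec_nat (F (pfst x) s)
      (\<lambda>k r. if r = 0 then 0 else G (prod_encode (pfst x, prod_encode (k, r - 1))) s) (psnd x)"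
  have "staged (\<lambda>n. rec_nat (f (pfst n))
      (\<lambda>k r. Option.bind r (\<lambda>v. g (prod_encode (pfst n, prod_encode (k, v))))) (psnd n)) ?H"
    using staged_rec[OF F(2) G(2)] unfolding staged_def by blast
  moreover have "recf A (\<lambda>e. ?H (pfst e) (psnd e))"
    by (simp only: One_nat_def, intro rec_intros recf_binary[OF F(1)] recf_binary[OF G(1)])
  ultimately show ?case
    unfolding pfst_def[symmetric] psnd_def[symmetric] by (intro exI[of _ ?H] conjI)
next
  case (search f)
  then obtain F where F: "recf A (\<lambda>e. F (pfst e) (psnd e))" "staged f F" by blast
  let ?C = "\<lambda>a s n. F (prod_encode (a, n)) s = 1 \<and> (\<forall>m<n. 1 < F (prod_encode (a, m)) s)"
  have "recf A (\<lambda>e. if \<exists>n<psnd e. ?C (pfst e) (psnd e) n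
      then Suc (LEAST n. ?C (pfst e) (psnd e) n \<or> n = psnd e) else 0)"
    by (intro rec_intros recf_binary[OF F(1)]) auto
  with staged_search[OF F(2)] show ?case
    by (intro exI[of _ "\<lambda>a s. if \<exists>n<s. ?C a s n then Suc (LEAST n. ?C a s n \<or> n = s) else 0"] conjI)
qed

lemma ce_in_stages:
  assumes "recp A (\<lambda>e. p (pfst e) (psnd e))"
  shows "ce_in A {x. \<exists>s. p x s}"
  unfolding ce_in_def using partrec_Least[OF assms]
  by (intro exI conjI) (auto split: if_splits)

text \<open>Monotonicity in the stage is recorded because the stage will later be tied to the length
  of a string, which turns an enumeration of strings into a decidable set.\<close>

lemma ce_in_stagesE:
  assumes "ce_in A S"
  obtains p where "recp A (\<lambda>e. p (pfst e) (psnd e))" "\<And>x. x \<in> S \<longleftrightarrow> (\<exists>s. p x s)"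
    "\<And>x s t. p x s \<Longrightarrow> s \<le> t \<Longrightarrow> p x t"
proof -
  obtain f where f: "partrec A f" "S = dom f" using assms by (auto simp: ce_in_def)
  obtain F where F: "recf A (\<lambda>e. F (pfst e) (psnd e))" "staged f F"
    using partrec_staged[OF f(1)] by blast
  show thesis
  proof
    show "recp A (\<lambda>e. 0 < F (pfst e) (psnd e))" by (intro rec_intros F)
    show "x \<in> S \<longleftrightarrow> (\<exists>s. 0 < F x s)" for x
      using staged_Some[OF F(2), of x] f(2) by (auto simp: domIff gr0_conv_Suc)
    show "0 < F x t" if "0 < F x s" "s \<le> t" for x s t
      using staged_mono[OF F(2) _ that(2)] that(1) by (auto simp: gr0_conv_Suc)
  qed
qed

subsection \<open>Strings and their codes\<close>

lemma string_code_Nil [simp]: "string_code [] = 0"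
  by (simp add: string_code_def)

lemma string_code_snoc [simp]: "string_code (\<sigma> @ [b]) = 2 * string_code \<sigma> + (if b then 2 else 1)"
  by (simp add: string_code_def)

lemma inj_string_code: "inj string_code"
proof (rule injI)
  show "string_code \<sigma> = string_code \<tau> \<Longrightarrow> \<sigma> = \<tau>" for \<sigma> \<tau>
  proof (induction \<sigma> arbitrary: \<tau> rule: rev_induct)
    case Nil
    then show ?case by (cases \<tau> rule: rev_cases) (auto split: if_splits)
  next
    case (snoc b \<sigma>)
    show ?case
    proof (cases \<tau> rule: rev_cases)
      case Nil
      with snoc.prems show ?thesis by (auto split: if_splits)
    next
      case (snoc \<tau>' b')
      have "string_code \<sigma> = string_code \<tau>'" "b = b'"
        using snoc.prems unfolding snoc by (auto split: if_splits) presburger+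
      with snoc snoc.IH show ?thesis by simp
    qed
  qed
qed

lemma surj_string_code: "surj string_code"
proof -
  have "\<exists>\<sigma>. string_code \<sigma> = c" for c
  proof (induction c rule: less_induct)
    case (less c)
    show ?case
    proof (cases "c = 0")
      case True
      then show ?thesis by (intro exI[of _ "[]"]) simp
    next
      case False
      then have "(c - 1) div 2 < c" by linarith
      with less obtain \<sigma> where "string_code \<sigma> = (c - 1) div 2" by blast
      then have "string_code (\<sigma> @ [even c]) = c" using False by auto
      then show ?thesis by blast
    qed
  qed
  then show ?thesis by (metis surjI)
qed

definition str_of :: "nat \<Rightarrow> str" where "str_of = inv string_code"

lemma str_of_code [simp]: "str_of (string_code \<sigma>) = \<sigma>"
  by (simp add: str_of_def inj_string_code)

lemma code_str_of [simp]: "string_code (str_of c) = c"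
  by (simp add: str_of_def surj_f_inv_f surj_string_code)

lemma code_in_image [simp]: "c \<in> string_code ` S \<longleftrightarrow> str_of c \<in> S"
  by (metis code_str_of image_iff str_of_code)

lemma string_code_bounds: "2 ^ length \<sigma> \<le> string_code \<sigma> + 1" "string_code \<sigma> + 2 \<le> 2 ^ Suc (length \<sigma>)"
  by (induction \<sigma> rule: rev_induct) auto

text \<open>The codes of the strings of length \<open>k\<close> fill the interval from
  \<open>2 ^ k - 1\<close> to \<open>2 ^ Suc k - 2\<close>, so the length is found by arithmetic on
  the code, without decoding.\<close>

lemma length_eq_Least: "length \<sigma> = (LEAST k. string_code \<sigma> + 2 \<le> 2 * 2 ^ k)"
proof (rule sym, rule Least_equality)
  show "string_code \<sigma> + 2 \<le> 2 * 2 ^ length \<sigma>" using string_code_bounds(2)[of \<sigma>] by simp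
  fix k assume k: "string_code \<sigma> + 2 \<le> 2 * 2 ^ k"
  show "length \<sigma> \<le> k"
  proof (rule ccontr)
    assume "\<not> length \<sigma> \<le> k"
    then have "(2::nat) ^ Suc k \<le> 2 ^ length \<sigma>" by (intro power_increasing) auto
    with k string_code_bounds(1)[of \<sigma>] show False by simp
  qed
qed

lemma recf_length [rec_intros]:
  assumes "recf A f"
  shows "recf A (\<lambda>x. length (str_of (f x)))"
proof -
  have "\<exists>k. f x + 2 \<le> 2 * 2 ^ k" for x
    using string_code_bounds(2)[of "str_of (f x)"] by auto
  then show ?thesis
    unfolding length_eq_Least code_str_of by (intro rec_intros recf_comp[OF assms])
qed

lemma recf_half [rec_intros]:
  assumes "recf A f"
  shows "recf A (\<lambda>x. f x div 2)"
proof -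
  have eq: "a div 2 = (LEAST k. a < 2 * Suc k)" for a :: nat
    by (rule sym, rule Least_equality) auto
  have "\<exists>k. f x < 2 * Suc k" for x by (rule exI[of _ "f x"]) simp
  then show ?thesis unfolding eq by (intro rec_intros recf_comp[OF assms])
qed

lemma recp_even [rec_intros]:
  assumes "recf A f"
  shows "recp A (\<lambda>x. even (f x))"
proof -
  have eq: "even a \<longleftrightarrow> 2 * (a div 2) = a" for a :: nat by presburger
  show ?thesis unfolding eq by (intro rec_intros assms)
qed

lemma code_butlast: "string_code (butlast \<sigma>) = (string_code \<sigma> - Suc 0) div 2"
  by (cases \<sigma> rule: rev_cases) auto

lemma code_take:
  "string_code (take n \<sigma>) = ((\<lambda>c. (c - Suc 0) div 2) ^^ (length \<sigma> - n)) (string_code \<sigma>)"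
proof -
  have "string_code (take (length \<sigma> - k) \<sigma>) = ((\<lambda>c. (c - Suc 0) div 2) ^^ k) (string_code \<sigma>)" for k
  proof (induction k)
    case (Suc k)
    have "take (length \<sigma> - Suc k) \<sigma> = butlast (take (length \<sigma> - k) \<sigma>)"
      by (simp add: butlast_take min_def)
    with Suc show ?case by (simp add: code_butlast)
  qed simp
  from this[of "length \<sigma> - n"] show ?thesis by (cases "n \<le> length \<sigma>") auto
qed

lemma recf_take [rec_intros]:
  assumes "recf A f" "recf A n"
  shows "recf A (\<lambda>x. string_code (take (n x) (str_of (f x))))"
  unfolding code_take code_str_of by (intro rec_intros assms)

lemma recp_tree_of [rec_intros]:
  assumes "recf (tree_oracle P) f"
  shows "recp (tree_oracle P) (\<lambda>x. str_of (f x) \<in> tree_of P)"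
  using recp_oracle[OF assms] by simp

lemma recp_branching [rec_intros]:
  assumes "recf (tree_oracle P) f"
  shows "recp (tree_oracle P) (\<lambda>x. branching P (str_of (f x)))"
proof -
  have *: "str_of (2 * c + 1) = str_of c @ [False]" "str_of (2 * c + 2) = str_of c @ [True]" for c
    using str_of_code[of "str_of c @ [False]"] str_of_code[of "str_of c @ [True]"] by simp_all
  show ?thesis
    unfolding branching_def *[symmetric] by (intro rec_intros assms)
qed

section \<open>The bits read at branching nodes\<close>

definition branch_bits :: "cantor set \<Rightarrow> str \<Rightarrow> str" where
  "branch_bits P \<sigma> = map (nth \<sigma>) (filter (\<lambda>j. branching P (take j \<sigma>)) [0..<length \<sigma>])"

lemma branch_bits_Nil [simp]: "branch_bits P [] = []"
  by (simp add: branch_bits_def)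

lemma branch_bits_snoc [simp]:
  "branch_bits P (\<sigma> @ [b]) = (if branching P \<sigma> then branch_bits P \<sigma> @ [b] else branch_bits P \<sigma>)"
proof -
  have "filter (\<lambda>j. branching P (take j (\<sigma> @ [b]))) [0..<length \<sigma>]
      = filter (\<lambda>j. branching P (take j \<sigma>)) [0..<length \<sigma>]"
    by (rule filter_cong) auto
  moreover have "map (nth (\<sigma> @ [b])) (filter p [0..<length \<sigma>]) = map (nth \<sigma>) (filter p [0..<length \<sigma>])" for p
    by (auto simp: nth_append)
  ultimately show ?thesis by (simp add: branch_bits_def)
qed

text \<open>The right-hand side is the index of the next bit of \<open>R\<close> in
  \<open>Psi_initial\<close>.\<close>

lemma length_branch_bits: "length (branch_bits P \<sigma>) = card {j. j < length \<sigma> \<and> branching P (take j \<sigma>)}"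
proof -
  have "length (branch_bits P \<sigma>) = card (set (filter (\<lambda>j. branching P (take j \<sigma>)) [0..<length \<sigma>]))"
    unfolding branch_bits_def length_map by (rule distinct_card[symmetric]) simp
  then show ?thesis by (simp add: conj_commute)
qed

lemma prefix_branch_bits: "prefix \<sigma> \<tau> \<Longrightarrow> prefix (branch_bits P \<sigma>) (branch_bits P \<tau>)"
  by (induction \<tau> rule: rev_induct) (auto simp: prefix_snoc)

text \<open>Appending \<open>True\<close> adds 2 to a doubled code and \<open>False\<close> adds 1,
  so bit \<open>j\<close> is the parity of the code of \<open>take (Suc j) \<sigma>\<close>. The
  recursion therefore uses only operations on codes.\<close>

lemma code_branch_bits:
  "string_code (branch_bits P \<sigma>) = rec_nat 0 (\<lambda>j r. if branching P (take j \<sigma>)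
     then 2 * r + (if even (string_code (take (Suc j) \<sigma>)) then 2 else 1) else r) (length \<sigma>)"
proof -
  have "string_code (branch_bits P (take m \<sigma>)) = rec_nat 0 (\<lambda>j r. if branching P (take j \<sigma>)
     then 2 * r + (if even (string_code (take (Suc j) \<sigma>)) then 2 else 1) else r) m" if "m \<le> length \<sigma>" for m
    using that by (induction m) (auto simp: take_Suc_conv_app_nth)
  from this[of "length \<sigma>"] show ?thesis by simp
qed

lemma recf_branch_bits [rec_intros]:
  assumes "recf (tree_oracle P) f"
  shows "recf (tree_oracle P) (\<lambda>x. string_code (branch_bits P (str_of (f x))))"
proof -
  have eq: "branching P (take j \<sigma>) \<longleftrightarrow> branching P (str_of (string_code (take j \<sigma>)))" for j \<sigma>
    by simp
  show ?thesis
    unfolding code_branch_bits by (subst eq) (intro rec_intros recf_comp[OF assms])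
qed

lemma recf_length_branch_bits [rec_intros]:
  assumes "recf (tree_oracle P) f"
  shows "recf (tree_oracle P) (\<lambda>x. length (branch_bits P (str_of (f x))))"
  using recf_length[OF recf_branch_bits[OF assms]] by simp

subsection \<open>Cantor space and produced paths\<close>

lemma length_initial [simp]: "length (initial X n) = n"
  by (simp add: initial_def)

lemma initial_0 [simp]: "initial X 0 = []"
  by (simp add: initial_def)

lemma initial_Suc: "initial X (Suc n) = initial X n @ [X n]"
  by (simp add: initial_def)

lemma take_initial: "m \<le> n \<Longrightarrow> take m (initial X n) = initial X m"
  by (simp add: initial_def take_map)

lemma prefix_initial: "m \<le> n \<Longrightarrow> prefix (initial X m) (initial X n)"
  by (metis take_initial take_is_prefix)

lemma in_cylinder: "X \<in> cylinder \<sigma> \<longleftrightarrow> initial X (length \<sigma>) = \<sigma>"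
  by (simp add: cylinder_def)

lemma in_cylinder_initial [simp]: "X \<in> cylinder (initial X n)"
  by (simp add: in_cylinder)

lemma cylinder_Nil [simp]: "cylinder [] = UNIV"
  by (simp add: cylinder_def)

lemma in_cylinder_snoc: "X \<in> cylinder (\<sigma> @ [b]) \<longleftrightarrow> X \<in> cylinder \<sigma> \<and> X (length \<sigma>) = b"
  by (simp add: in_cylinder initial_Suc)

lemma in_cylinder_nth: "X \<in> cylinder \<sigma> \<longleftrightarrow> (\<forall>i<length \<sigma>. X i = \<sigma> ! i)"
  unfolding in_cylinder initial_def list_eq_iff_nth_eq by simp

lemma cylinder_antimono: "prefix \<sigma> \<tau> \<Longrightarrow> cylinder \<tau> \<subseteq> cylinder \<sigma>"
proof
  fix X assume "prefix \<sigma> \<tau>" "X \<in> cylinder \<tau>"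
  then obtain \<upsilon> where "\<tau> = \<sigma> @ \<upsilon>" "\<forall>i<length \<tau>. X i = \<tau> ! i" by (auto simp: prefix_def in_cylinder_nth)
  then show "X \<in> cylinder \<sigma>" unfolding in_cylinder_nth by (simp add: nth_append)
qed

lemma cylinder_comparable: "X \<in> cylinder \<sigma> \<Longrightarrow> X \<in> cylinder \<tau> \<Longrightarrow> prefix \<sigma> \<tau> \<or> prefix \<tau> \<sigma>"
proof -
  assume "X \<in> cylinder \<sigma>" "X \<in> cylinder \<tau>"
  then have eq: "initial X (length \<sigma>) = \<sigma>" "initial X (length \<tau>) = \<tau>" by (simp_all only: in_cylinder)
  have "prefix (initial X (length \<sigma>)) (initial X (length \<tau>)) \<or>
      prefix (initial X (length \<tau>)) (initial X (length \<sigma>))"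
    using nat_le_linear[of "length \<sigma>" "length \<tau>"] prefix_initial by blast
  then show ?thesis by (simp only: eq)
qed

lemma cylinder_nonempty: "cylinder \<sigma> \<noteq> {}"
proof -
  have "(\<lambda>i. \<sigma> ! i) \<in> cylinder \<sigma>" by (simp add: in_cylinder_nth)
  then show ?thesis by blast
qed

lemma cylinder_split: "cylinder \<sigma> = cylinder (\<sigma> @ [False]) \<union> cylinder (\<sigma> @ [True])"
  by (auto simp: in_cylinder_snoc)

lemma in_open_of: "X \<in> open_of S \<longleftrightarrow> (\<exists>\<sigma>\<in>S. X \<in> cylinder \<sigma>)"
  by (simp add: open_of_def)

section \<open>Antichains generating open sets, and comparison of measures\<close>

definition minimal_strings :: "str set \<Rightarrow> str set" where
  "minimal_strings S = {\<sigma> \<in> S. \<forall>\<tau>\<in>S. prefix \<tau> \<sigma> \<longrightarrow> \<tau> = \<sigma>}"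

lemma minimal_strings_below:
  assumes "\<sigma> \<in> S"
  obtains \<tau> where "\<tau> \<in> minimal_strings S" "prefix \<tau> \<sigma>"
proof -
  have "\<exists>\<tau>\<in>minimal_strings S. prefix \<tau> \<sigma>"
    using assms
  proof (induction "length \<sigma>" arbitrary: \<sigma> rule: less_induct)
    case less
    show ?case
    proof (cases "\<sigma> \<in> minimal_strings S")
      case False
      with less.prems obtain \<tau> where "\<tau> \<in> S" "strict_prefix \<tau> \<sigma>"
        by (auto simp: minimal_strings_def strict_prefix_def)
      with less.hyps[OF prefix_length_less] show ?thesis
        using prefix_order.trans[of _ \<tau> \<sigma>] by (auto simp: strict_prefix_def)
    qed auto
  qed
  then show thesis using that by blast
qed

lemma open_of_minimal_strings: "open_of (minimal_strings S) = open_of S"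
proof
  show "open_of (minimal_strings S) \<subseteq> open_of S"
    by (auto simp: open_of_def minimal_strings_def)
  show "open_of S \<subseteq> open_of (minimal_strings S)"
  proof
    fix X assume "X \<in> open_of S"
    then obtain \<sigma> where \<sigma>: "\<sigma> \<in> S" "X \<in> cylinder \<sigma>" by (auto simp: in_open_of)
    obtain \<tau> where "\<tau> \<in> minimal_strings S" "prefix \<tau> \<sigma>" using minimal_strings_below[OF \<sigma>(1)] .
    with \<sigma>(2) show "X \<in> open_of (minimal_strings S)"
      using cylinder_antimono unfolding in_open_of by blast
  qed
qed

lemma minimal_strings_disjoint:
  assumes "\<sigma> \<in> minimal_strings S" "\<tau> \<in> minimal_strings S" "cylinder \<sigma> \<inter> cylinder \<tau> \<noteq> {}"
  shows "\<sigma> = \<tau>"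
proof -
  have "prefix \<sigma> \<tau> \<or> prefix \<tau> \<sigma>" using assms(3) cylinder_comparable by blast
  with assms(1,2) show ?thesis unfolding minimal_strings_def by auto
qed

text \<open>The estimate behind the transfers of tests. The minimal strings of \<open>S\<close> have
  disjoint cylinders with union \<open>open_of S\<close>, so the left side is a sum, bounded term by
  term; by \<open>disj\<close> their images under \<open>g\<close> are disjoint too, and they all
  lie in \<open>V\<close>. Below, \<open>g\<close> is \<open>branch_bits\<close>, a choice of
  preimages under it, or a choice of short programs.\<close>

lemma emeasure_open_of_le:
  assumes M: "\<And>\<sigma>. cylinder \<sigma> \<in> sets M" and N: "\<And>\<sigma>. cylinder \<sigma> \<in> sets N"
    and V: "V \<in> sets N" "\<And>\<sigma>. \<sigma> \<in> S \<Longrightarrow> cylinder (g \<sigma>) \<subseteq> V"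
    and disj: "\<And>\<sigma> \<tau>. \<sigma> \<in> S \<Longrightarrow> \<tau> \<in> S \<Longrightarrow> cylinder (g \<sigma>) \<inter> cylinder (g \<tau>) \<noteq> {} \<Longrightarrow>
      cylinder \<sigma> \<inter> cylinder \<tau> \<noteq> {}"
    and le: "\<And>\<sigma>. \<sigma> \<in> S \<Longrightarrow> emeasure M (cylinder \<sigma>) \<le> c * emeasure N (cylinder (g \<sigma>))"
  shows "emeasure M (open_of S) \<le> c * emeasure N V"
proof -
  let ?S = "minimal_strings S"
  have sub: "?S \<subseteq> S" by (auto simp: minimal_strings_def)
  have 1: "disjoint_family_on cylinder ?S"
    unfolding disjoint_family_on_def using minimal_strings_disjoint by metis
  have 2: "disjoint_family_on (\<lambda>\<sigma>. cylinder (g \<sigma>)) ?S"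
    unfolding disjoint_family_on_def
  proof (intro ballI impI)
    fix \<sigma> \<tau> assume *: "\<sigma> \<in> ?S" "\<tau> \<in> ?S" "\<sigma> \<noteq> \<tau>"
    then show "cylinder (g \<sigma>) \<inter> cylinder (g \<tau>) = {}"
      using disj[of \<sigma> \<tau>] minimal_strings_disjoint[OF *(1,2)] sub by auto
  qed
  have "emeasure M (open_of S) = emeasure M (\<Union>\<sigma>\<in>?S. cylinder \<sigma>)"
    using open_of_minimal_strings[of S] by (simp add: open_of_def)
  also have "\<dots> = (\<integral>\<^sup>+\<sigma>. emeasure M (cylinder \<sigma>) \<partial>count_space ?S)"
    by (rule emeasure_UN_countable[OF M _ 1]) simp_all
  also have "\<dots> \<le> (\<integral>\<^sup>+\<sigma>. c * emeasure N (cylinder (g \<sigma>)) \<partial>count_space ?S)"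
    using le sub by (intro nn_integral_mono) auto
  also have "\<dots> = c * (\<integral>\<^sup>+\<sigma>. emeasure N (cylinder (g \<sigma>)) \<partial>count_space ?S)"
    by (rule nn_integral_cmult) simp
  also have "(\<integral>\<^sup>+\<sigma>. emeasure N (cylinder (g \<sigma>)) \<partial>count_space ?S) = emeasure N (\<Union>\<sigma>\<in>?S. cylinder (g \<sigma>))"
    by (rule emeasure_UN_countable[OF N _ 2, symmetric]) simp_all
  also have "c * \<dots> \<le> c * emeasure N V"
    using V sub by (intro mult_left_mono emeasure_mono) auto
  finally show ?thesis .
qed

lemma sets_open_of: "(\<And>\<sigma>. cylinder \<sigma> \<in> sets M) \<Longrightarrow> open_of S \<in> sets M"
  unfolding open_of_def by (intro sets.countable_UN') auto

section \<open>The uniform measure on cylinders\<close>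

lemma cantor_lebesgue_cylinder:
  shows sets_cantor_lebesgue_cylinder [simp]: "cylinder \<sigma> \<in> sets cantor_lebesgue"
    and emeasure_cantor_lebesgue_cylinder: "emeasure cantor_lebesgue (cylinder \<sigma>) = ennreal ((1/2) ^ length \<sigma>)"
proof -
  let ?M = "\<lambda>_::nat. measure_pmf (bernoulli_pmf (1/2))"
  let ?J = "{..<length \<sigma>}"
  interpret product_prob_space ?M UNIV by unfold_locales
  have eq: "cylinder \<sigma> = prod_emb UNIV ?M ?J (Pi\<^sub>E ?J (\<lambda>i. {\<sigma> ! i}))"
    by (auto simp: in_cylinder_nth prod_emb_def PiE_def Pi_def)
  show "cylinder \<sigma> \<in> sets cantor_lebesgue"
    unfolding eq cantor_lebesgue_def by (rule sets_PiM_I) auto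
  have "emeasure cantor_lebesgue (cylinder \<sigma>) = (\<Prod>i\<in>?J. emeasure (?M i) {\<sigma> ! i})"
    unfolding eq cantor_lebesgue_def by (rule emeasure_PiM_emb) auto
  also have "\<dots> = (\<Prod>i\<in>?J. ennreal (1/2))"
  proof (rule prod.cong)
    show "emeasure (?M i) {\<sigma> ! i} = ennreal (1/2)" for i
      by (cases "\<sigma> ! i") (simp_all add: emeasure_pmf_single)
  qed simp
  also have "\<dots> = ennreal ((1/2) ^ length \<sigma>)"
    by (simp only: prod_constant card_lessThan ennreal_power zero_le_divide_1_iff zero_le_numeral)
  finally show "emeasure cantor_lebesgue (cylinder \<sigma>) = ennreal ((1/2) ^ length \<sigma>)" .
qed

lemma prob_space_cantor_lebesgue: "prob_space cantor_lebesgue"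
proof -
  interpret product_prob_space "\<lambda>_::nat. measure_pmf (bernoulli_pmf (1/2))" UNIV by unfold_locales
  show ?thesis unfolding cantor_lebesgue_def by unfold_locales
qed

lemma measure_cantor_lebesgue_cylinder: "measure cantor_lebesgue (cylinder \<sigma>) = (1/2) ^ length \<sigma>"
  by (simp add: measure_def emeasure_cantor_lebesgue_cylinder)

text \<open>Terms for the derivations of \<open>partrec\<close>, introduced only for counting: a
  countable datatype can define only countably many partial functions, hence only countably many
  tests.\<close>

datatype partrec_code = Zero | Succ | First | Second | Query | Pairing partrec_code partrec_code
  | Compose partrec_code partrec_code | Primrec partrec_code partrec_code | Search partrec_code

instance partrec_code :: countable
  by countable_datatype

primrec interpret_code :: "nat set \<Rightarrow> partrec_code \<Rightarrow> nat \<rightharpoonup> nat" where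
  "interpret_code A Zero = (\<lambda>_. Some 0)"
| "interpret_code A Succ = (\<lambda>n. Some (Suc n))"
| "interpret_code A First = (\<lambda>n. Some (fst (prod_decode n)))"
| "interpret_code A Second = (\<lambda>n. Some (snd (prod_decode n)))"
| "interpret_code A Query = (\<lambda>n. Some (if n \<in> A then 1 else 0))"
| "interpret_code A (Pairing p q) = (\<lambda>n. Option.bind (interpret_code A p n)
    (\<lambda>a. Option.bind (interpret_code A q n) (\<lambda>b. Some (prod_encode (a, b)))))"
| "interpret_code A (Compose p q) = (\<lambda>n. Option.bind (interpret_code A q n) (interpret_code A p))"
| "interpret_code A (Primrec p q) = (\<lambda>n. rec_nat (interpret_code A p (fst (prod_decode n)))
    (\<lambda>k r. Option.bind r (\<lambda>v. interpret_code A q (prod_encode (fst (prod_decode n), prod_encode (k, v)))))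
    (snd (prod_decode n)))"
| "interpret_code A (Search p) = (\<lambda>a. if \<exists>n. interpret_code A p (prod_encode (a, n)) = Some 0 \<and>
      (\<forall>m<n. interpret_code A p (prod_encode (a, m)) \<noteq> None)
    then Some (LEAST n. interpret_code A p (prod_encode (a, n)) = Some 0) else None)"

lemma partrec_interpret_code: "partrec A f \<Longrightarrow> \<exists>p. f = interpret_code A p"
proof (induction rule: partrec.induct)
  case zero show ?case by (rule exI[of _ Zero]) simp
next
  case succ show ?case by (rule exI[of _ Succ]) simp
next
  case left show ?case by (rule exI[of _ First]) simp
next
  case right show ?case by (rule exI[of _ Second]) simp
next
  case oracle_query show ?case by (rule exI[of _ Query]) simp
next
  case (pair f g)
  then obtain p q where "f = interpret_code A p" "g = interpret_code A q" by blast
  then show ?case by (intro exI[of _ "Pairing p q"]) simp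
next
  case (comp f g)
  then obtain p q where "f = interpret_code A p" "g = interpret_code A q" by blast
  then show ?case by (intro exI[of _ "Compose p q"]) simp
next
  case (prec f g)
  then obtain p q where "f = interpret_code A p" "g = interpret_code A q" by blast
  then show ?case by (intro exI[of _ "Primrec p q"]) simp
next
  case (search f)
  then obtain p where "f = interpret_code A p" by blast
  then show ?case by (intro exI[of _ "Search p"]) (simp only: interpret_code.simps)
qed

lemma countable_ce_in: "countable {S. ce_in A S}"
proof -
  have "{S. ce_in A S} \<subseteq> range (\<lambda>p. dom (interpret_code A p))"
    using partrec_interpret_code by (fastforce simp: ce_in_def)
  then show ?thesis by (rule countable_subset) simp
qed

text \<open>There are only countably many Martin-Loef tests, and each captures a null set.\<close>

lemma MLR_meets_cylinder:
  assumes M: "\<And>\<sigma>. cylinder \<sigma> \<in> sets M" and pos: "emeasure M (cylinder \<sigma>) > 0"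
  obtains X where "X \<in> MLR A M" "X \<in> cylinder \<sigma>"
proof -
  define \<U> where "\<U> E n = open_of {\<sigma>. prod_encode (n, string_code \<sigma>) \<in> E}" for E :: "nat set" and n :: nat
  define Es where "Es = {E. ce_in A E \<and> (\<forall>n. emeasure M (\<U> E n) \<le> ennreal ((1/2) ^ n))}"
  have "countable Es" unfolding Es_def by (rule countable_subset[OF _ countable_ce_in]) auto
  have "(\<Inter>n. \<U> E n) \<in> null_sets M" if "E \<in> Es" for E
  proof -
    have sets: "\<U> E n \<in> sets M" for n unfolding \<U>_def by (rule sets_open_of[OF M])
    have "emeasure M (\<Inter>n. \<U> E n) \<le> ennreal ((1/2) ^ n)" for n
    proof -
      have "emeasure M (\<Inter>n. \<U> E n) \<le> emeasure M (\<U> E n)"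
        by (rule emeasure_mono[OF _ sets]) auto
      also have "\<dots> \<le> ennreal ((1/2) ^ n)" using that by (simp add: Es_def)
      finally show ?thesis .
    qed
    moreover have "(\<lambda>n. ennreal ((1/2) ^ n)) \<longlonglongrightarrow> ennreal 0"
      by (intro tendsto_ennrealI LIMSEQ_power_zero) simp
    ultimately have "emeasure M (\<Inter>n. \<U> E n) \<le> ennreal 0"
      by (intro LIMSEQ_le_const) auto
    then show ?thesis using sets by (intro null_setsI) auto
  qed
  then have "(\<Union>E\<in>Es. \<Inter>n. \<U> E n) \<in> null_sets M"
    by (intro null_sets_UN'[OF \<open>countable Es\<close>])
  then have null: "emeasure M (\<Union>E\<in>Es. \<Inter>n. \<U> E n) = 0" "(\<Union>E\<in>Es. \<Inter>n. \<U> E n) \<in> sets M"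
    by (simp_all add: null_setsD1 null_setsD2)
  have "\<not> cylinder \<sigma> \<subseteq> (\<Union>E\<in>Es. \<Inter>n. \<U> E n)"
  proof
    assume "cylinder \<sigma> \<subseteq> (\<Union>E\<in>Es. \<Inter>n. \<U> E n)"
    from emeasure_mono[OF this null(2)] pos show False unfolding null(1) by simp
  qed
  then obtain X where X: "X \<in> cylinder \<sigma>" "X \<notin> (\<Union>E\<in>Es. \<Inter>n. \<U> E n)" by blast
  have "X \<in> MLR A M"
    unfolding MLR_def
  proof (intro CollectI allI impI)
    fix \<V> assume "uniformly_ce_open A \<V>" and le: "\<forall>n. emeasure M (\<V> n) \<le> ennreal ((1/2) ^ n)"
    then obtain S where S: "ce_in A {prod_encode (n, string_code \<sigma>) | n \<sigma>. \<sigma> \<in> S n}" (is "ce_in A ?E")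
      and \<V>: "\<And>n. \<V> n = open_of (S n)"
      by (auto simp: uniformly_ce_open_def)
    have "{\<sigma>. prod_encode (n, string_code \<sigma>) \<in> ?E} = S n" for n
    proof
      show "{\<sigma>. prod_encode (n, string_code \<sigma>) \<in> ?E} \<subseteq> S n"
      proof
        fix \<sigma> assume "\<sigma> \<in> {\<sigma>. prod_encode (n, string_code \<sigma>) \<in> ?E}"
        then obtain m \<tau> where "prod_encode (n, string_code \<sigma>) = prod_encode (m, string_code \<tau>)" "\<tau> \<in> S m"
          by blast
        then show "\<sigma> \<in> S n" using inj_string_code by (simp add: prod_encode_eq inj_eq)
      qed
    qed blast
    then have "\<U> ?E = \<V>" unfolding \<U>_def fun_eq_iff \<V> by simp
    then have "?E \<in> Es" using S le by (simp add: Es_def)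
    then have "X \<notin> (\<Inter>n. \<U> ?E n)" using X(2) by blast
    then show "X \<notin> (\<Inter>n. \<V> n)" unfolding \<open>\<U> ?E = \<V>\<close> .
  qed
  with X(1) show thesis using that by blast
qed

section \<open>The tree of a class and the paths produced in it\<close>

lemma prefix_in_tree_of: "\<tau> \<in> tree_of P \<Longrightarrow> prefix \<sigma> \<tau> \<Longrightarrow> \<sigma> \<in> tree_of P"
  unfolding tree_of_def using cylinder_antimono by blast

lemma snoc_in_tree_ofD: "\<sigma> @ [b] \<in> tree_of P \<Longrightarrow> \<sigma> \<in> tree_of P"
  by (erule prefix_in_tree_of) simp

lemma tree_of_extend: "\<sigma> \<in> tree_of P \<Longrightarrow> \<exists>b. \<sigma> @ [b] \<in> tree_of P"
  unfolding tree_of_def using cylinder_split[of \<sigma>] by blast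

lemma initial_in_tree_of: "X \<in> P \<Longrightarrow> initial X n \<in> tree_of P"
  unfolding tree_of_def using in_cylinder_initial by blast

lemma length_Psi_initial [simp]: "length (Psi_initial P R m) = m"
  by (induction m) (simp_all add: Let_def)

lemma initial_Psi: "initial (Psi P R) m = Psi_initial P R m"
proof (induction m)
  case (Suc m)
  then show ?case by (simp add: initial_Suc Psi_def Let_def)
qed simp

text \<open>At a branching node the path copies the next unread bit of \<open>R\<close>, which is
  the bit that \<open>branch_bits\<close> appends; elsewhere the extension is forced and lying in
  the tree is the only condition.\<close>

lemma Psi_in_cylinder:
  assumes "P \<noteq> {}"
  shows "Psi P R \<in> cylinder \<sigma> \<longleftrightarrow> \<sigma> \<in> tree_of P \<and> R \<in> cylinder (branch_bits P \<sigma>)"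
proof (induction \<sigma> rule: rev_induct)
  case Nil
  then show ?case using assms by (simp add: tree_of_def)
next
  case (snoc b \<sigma>)
  show ?case
  proof (cases "Psi P R \<in> cylinder \<sigma>")
    case True
    with snoc have \<sigma>: "\<sigma> \<in> tree_of P" "R \<in> cylinder (branch_bits P \<sigma>)" by auto
    have "Psi_initial P R (length \<sigma>) = \<sigma>" using True by (simp add: in_cylinder initial_Psi)
    then have val: "Psi P R (length \<sigma>) = (if branching P \<sigma> then R (length (branch_bits P \<sigma>))
        else (THE i. \<sigma> @ [i] \<in> tree_of P))"
      by (simp add: Psi_def Let_def length_branch_bits)
    show ?thesis
    proof (cases "branching P \<sigma>")
      case br: True
      then have "\<sigma> @ [b] \<in> tree_of P" by (cases b) (auto simp: branching_def)
      with True br \<sigma> val show ?thesis by (simp add: in_cylinder_snoc)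
    next
      case br: False
      obtain i where i: "\<sigma> @ [i] \<in> tree_of P" using tree_of_extend[OF \<sigma>(1)] by blast
      have uniq: "j = i" if "\<sigma> @ [j] \<in> tree_of P" for j
        using that i br unfolding branching_def by (cases i; cases j) simp_all
      have "(THE i. \<sigma> @ [i] \<in> tree_of P) = i" using i uniq by (rule the_equality)
      moreover have "\<sigma> @ [b] \<in> tree_of P \<longleftrightarrow> i = b"
      proof
        assume "\<sigma> @ [b] \<in> tree_of P"
        then show "i = b" using uniq by simp
      qed (use i in simp)
      ultimately show ?thesis using True br \<sigma> val by (simp add: in_cylinder_snoc)
    qed
  next
    case False
    then have "\<sigma> \<notin> tree_of P \<or> R \<notin> cylinder (branch_bits P \<sigma>)" using snoc by blast
    then have "\<sigma> @ [b] \<notin> tree_of P \<or> R \<notin> cylinder (branch_bits P (\<sigma> @ [b]))"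
      using snoc_in_tree_ofD[of \<sigma> b P] by (cases "branching P \<sigma>") (simp_all add: in_cylinder_snoc, blast?)
    with False show ?thesis unfolding in_cylinder_snoc[of "Psi P R"] by blast
  qed
qed

lemma Psi_eqI:
  assumes "X \<in> P" "\<And>m. R \<in> cylinder (branch_bits P (initial X m))"
  shows "Psi P R = X"
proof
  fix m
  have "Psi P R \<in> cylinder (initial X (Suc m))"
    using assms Psi_in_cylinder[of P R] initial_in_tree_of by blast
  then show "Psi P R m = X m" by (simp add: initial_Suc in_cylinder_snoc)
qed

text \<open>A common extension \<open>R\<close> of both bit strings produces a path that passes
  through both \<open>\<sigma>\<close> and \<open>\<tau>\<close>.\<close>

lemma branch_bits_disjoint:
  assumes "P \<noteq> {}" "\<sigma> \<in> tree_of P" "\<tau> \<in> tree_of P"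
    and "cylinder (branch_bits P \<sigma>) \<inter> cylinder (branch_bits P \<tau>) \<noteq> {}"
  shows "cylinder \<sigma> \<inter> cylinder \<tau> \<noteq> {}"
  using assms Psi_in_cylinder by blast

subsection \<open>The limiting relative measure\<close>

locale cylinder_mass =
  fixes \<nu> :: "str \<Rightarrow> real"
  assumes nonneg: "0 \<le> \<nu> \<sigma>" and total: "\<nu> [] = 1"
    and additive: "\<nu> \<sigma> = \<nu> (\<sigma> @ [False]) + \<nu> (\<sigma> @ [True])"
begin

text \<open>
  Inverse transform sampling: the strings of a given length partition \<open>[0, 1)\<close>, in lexicographic
  order, into intervals of length \<open>\<nu> \<sigma>\<close> with left endpoint \<open>lower \<sigma>\<close>, and the Lebesgue measure is
  pushed forward along the map that sends a point to the sequence of its intervals.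
\<close>

definition lower :: "str \<Rightarrow> real" where
  "lower \<sigma> = (\<Sum>j<length \<sigma>. if \<sigma> ! j then \<nu> (take j \<sigma> @ [False]) else 0)"

lemma lower_Nil [simp]: "lower [] = 0"
  by (simp add: lower_def)

lemma lower_snoc [simp]: "lower (\<sigma> @ [b]) = lower \<sigma> + (if b then \<nu> (\<sigma> @ [False]) else 0)"
proof -
  have "(\<Sum>j<length \<sigma>. if (\<sigma> @ [b]) ! j then \<nu> (take j (\<sigma> @ [b]) @ [False]) else 0) = lower \<sigma>"
    unfolding lower_def by (rule sum.cong) (auto simp: nth_append)
  then show ?thesis by (simp add: lower_def)
qed

definition cell :: "str \<Rightarrow> real set" where
  "cell \<sigma> = {lower \<sigma>..<lower \<sigma> + \<nu> \<sigma>}"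

text \<open>The threshold cuts a half-open cell into two half-open cells, one of them possibly
  empty, so no point is lost or counted twice.\<close>

lemma cell_snoc: "u \<in> cell (\<sigma> @ [b]) \<longleftrightarrow> u \<in> cell \<sigma> \<and> (lower \<sigma> + \<nu> (\<sigma> @ [False]) \<le> u) = b"
  using additive[of \<sigma>] nonneg[of "\<sigma> @ [False]"] nonneg[of "\<sigma> @ [True]"]
  by (cases b) (auto simp: cell_def)

lemma cell_subset: "cell \<sigma> \<subseteq> {0..<1}"
  by (induction \<sigma> rule: rev_induct) (auto simp: cell_snoc, auto simp: cell_def total)

primrec sample_initial :: "real \<Rightarrow> nat \<Rightarrow> str" where
  "sample_initial u 0 = []"
| "sample_initial u (Suc n) = sample_initial u n @
    [lower (sample_initial u n) + \<nu> (sample_initial u n @ [False]) \<le> u]"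

definition sample :: "real \<Rightarrow> cantor" where
  "sample u n = last (sample_initial u (Suc n))"

lemma initial_sample: "initial (sample u) n = sample_initial u n"
  by (induction n) (simp_all add: initial_Suc sample_def)

lemma sample_in_cylinder:
  assumes "u \<in> {0..<1}"
  shows "sample u \<in> cylinder \<sigma> \<longleftrightarrow> u \<in> cell \<sigma>"
proof (induction \<sigma> rule: rev_induct)
  case Nil
  then show ?case using assms by (simp add: cell_def total)
next
  case (snoc b \<sigma>)
  have "sample u (length \<sigma>) = (lower \<sigma> + \<nu> (\<sigma> @ [False]) \<le> u)" if "sample u \<in> cylinder \<sigma>"
    using that by (simp add: sample_def in_cylinder initial_sample)
  with snoc show ?case unfolding in_cylinder_snoc cell_snoc by blast
qed

text \<open>The values prescribed to \<open>extend_measure\<close> are attained only if some measure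
  has them. The witness is \<open>N\<close>, the image under \<open>sample\<close> of Lebesgue
  measure on the unit interval; it gives a cylinder the length of its cell.\<close>

lemma extend_measure_cylinder:
  fixes \<sigma> :: str
  defines "M \<equiv> extend_measure UNIV UNIV cylinder (\<lambda>\<sigma>. ennreal (\<nu> \<sigma>))"
  shows "cylinder \<sigma> \<in> sets M" and "emeasure M (cylinder \<sigma>) = ennreal (\<nu> \<sigma>)"
proof -
  let ?S = "sigma UNIV (range cylinder)" and ?L = "restrict_space lborel {0..<1::real}"
  define N where "N = distr ?L ?S sample"
  have vimage: "sample -` cylinder \<sigma> \<inter> {0..<1} = cell \<sigma>" for \<sigma>
    using sample_in_cylinder[of _ \<sigma>] cell_subset[of \<sigma>] by auto
  have "cell \<sigma> \<in> sets ?L" for \<sigma>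
    using cell_subset[of \<sigma>] unfolding cell_def by (simp add: sets_restrict_space_iff)
  then have meas: "sample \<in> measurable ?L ?S"
    by (intro measurable_measure_of) (auto simp: space_restrict_space vimage)
  have sets_M: "sets M = sets ?S"
    unfolding M_def by (simp add: sets_extend_measure sets_measure_of)
  then show sets: "cylinder \<sigma> \<in> sets M" by simp
  have "emeasure N (cylinder \<sigma>) = ennreal (\<nu> \<sigma>)" for \<sigma>
  proof -
    have "emeasure N (cylinder \<sigma>) = emeasure ?L (cell \<sigma>)"
      unfolding N_def by (subst emeasure_distr[OF meas]) (simp_all add: space_restrict_space vimage)
    also have "\<dots> = emeasure lborel (cell \<sigma>)"
      using cell_subset by (intro emeasure_restrict_space) auto
    also have "\<dots> = ennreal (\<nu> \<sigma>)" using nonneg[of \<sigma>] by (simp add: cell_def)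
    finally show ?thesis .
  qed
  moreover have "positive (sets M) (emeasure N)" "countably_additive (sets M) (emeasure N)"
    using emeasure_positive[of N] emeasure_countably_additive[of N] by (simp_all add: sets_M N_def)
  ultimately show "emeasure M (cylinder \<sigma>) = ennreal (\<nu> \<sigma>)"
    by (intro emeasure_extend_measure[OF M_def[THEN meta_eq_to_obj_eq]]) auto
qed

end

section \<open>Levels of the tree and branching weights\<close>

lemma finite_level [simp]: "finite (level P n)"
  by (rule finite_subset[OF _ finite_lists_length_eq[of "UNIV :: bool set" n]]) (auto simp: level_def)

lemma length_level: "\<sigma> \<in> level P n \<Longrightarrow> length \<sigma> = n"
  by (simp add: level_def)

lemma level_tree_of: "\<sigma> \<in> level P n \<Longrightarrow> \<sigma> \<in> tree_of P"
  by (simp add: level_def)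

lemma equal_length_disjoint:
  assumes "length \<sigma> = length \<tau>" "cylinder \<sigma> \<inter> cylinder \<tau> \<noteq> {}"
  shows "\<sigma> = \<tau>"
  using assms by (metis disjoint_iff in_cylinder)

text \<open>For \<open>\<sigma>\<close> on the tree, the flip of
  \<open>take (Suc j) \<sigma>\<close> is on the tree iff \<open>take j \<sigma>\<close> branches.
  The positions counted by \<open>theta\<close> are thus those of the branching nodes shifted by
  one.\<close>

lemma theta_eq_length_branch_bits:
  assumes "\<sigma> \<in> tree_of P"
  shows "theta P \<sigma> = length (branch_bits P \<sigma>)"
proof -
  have *: "flip_last (take (Suc j) \<sigma>) \<in> tree_of P \<longleftrightarrow> branching P (take j \<sigma>)" if "j < length \<sigma>" for j
  proof -
    have "take (Suc j) \<sigma> \<in> tree_of P" using assms take_is_prefix by (rule prefix_in_tree_of)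
    with that have "take j \<sigma> @ [\<sigma> ! j] \<in> tree_of P" by (simp add: take_Suc_conv_app_nth)
    moreover have "flip_last (take (Suc j) \<sigma>) = take j \<sigma> @ [\<not> \<sigma> ! j]"
      using that by (simp add: flip_last_def take_Suc_conv_app_nth)
    ultimately show ?thesis by (cases "\<sigma> ! j") (simp_all add: branching_def)
  qed
  have "{n. 1 \<le> n \<and> n \<le> length \<sigma> \<and> flip_last (take n \<sigma>) \<in> tree_of P}
      = Suc ` {j. j < length \<sigma> \<and> branching P (take j \<sigma>)}" (is "?l = ?r")
  proof (intro equalityI subsetI)
    fix n assume "n \<in> ?l"
    then show "n \<in> ?r" using * by (cases n) auto
  qed (use * in auto)
  then show ?thesis by (simp add: theta_def length_branch_bits card_image)
qed

text \<open>Every \<open>R\<close> extending the bits of \<open>\<sigma>\<close> produces a path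
  through exactly one string of level \<open>n\<close> above \<open>\<sigma>\<close>. The cylinders
  of the bits of these strings therefore partition that of \<open>\<sigma>\<close>, and their
  Lebesgue measures add up.\<close>

lemma sum_branch_weights:
  assumes "P \<noteq> {}" "\<sigma> \<in> tree_of P" "length \<sigma> \<le> n"
  shows "(\<Sum>\<tau>\<in>{\<tau> \<in> level P n. prefix \<sigma> \<tau>}. (1/2) ^ length (branch_bits P \<tau>)) = (1/2 :: real) ^ length (branch_bits P \<sigma>)"
proof -
  interpret prob_space cantor_lebesgue by (rule prob_space_cantor_lebesgue)
  let ?L = "{\<tau> \<in> level P n. prefix \<sigma> \<tau>}"
  have "cylinder (branch_bits P \<sigma>) = (\<Union>\<tau>\<in>?L. cylinder (branch_bits P \<tau>))"
  proof (intro equalityI subsetI)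
    fix R assume "R \<in> cylinder (branch_bits P \<sigma>)"
    then have "Psi P R \<in> cylinder \<sigma>" using assms Psi_in_cylinder by blast
    let ?\<tau> = "initial (Psi P R) n"
    have "?\<tau> \<in> tree_of P" "R \<in> cylinder (branch_bits P ?\<tau>)"
      using Psi_in_cylinder[OF assms(1), of R ?\<tau>] by simp_all
    moreover have "prefix \<sigma> ?\<tau>"
      using \<open>Psi P R \<in> cylinder \<sigma>\<close> prefix_initial[OF assms(3), of "Psi P R"] by (simp add: in_cylinder)
    ultimately show "R \<in> (\<Union>\<tau>\<in>?L. cylinder (branch_bits P \<tau>))" by (auto simp: level_def)
  next
    fix R assume "R \<in> (\<Union>\<tau>\<in>?L. cylinder (branch_bits P \<tau>))"
    then show "R \<in> cylinder (branch_bits P \<sigma>)"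
      using cylinder_antimono[OF prefix_branch_bits] by blast
  qed
  moreover have "disjoint_family_on (\<lambda>\<tau>. cylinder (branch_bits P \<tau>)) ?L"
    unfolding disjoint_family_on_def
  proof (intro ballI impI, rule ccontr)
    fix \<tau> \<upsilon> assume *: "\<tau> \<in> ?L" "\<upsilon> \<in> ?L" "\<tau> \<noteq> \<upsilon>" and "cylinder (branch_bits P \<tau>) \<inter> cylinder (branch_bits P \<upsilon>) \<noteq> {}"
    then have "cylinder \<tau> \<inter> cylinder \<upsilon> \<noteq> {}"
      using branch_bits_disjoint[OF assms(1)] by (simp add: level_def)
    with * show False using equal_length_disjoint[of \<tau> \<upsilon>] by (simp add: level_def)
  qed
  ultimately have "measure cantor_lebesgue (cylinder (branch_bits P \<sigma>))
      = (\<Sum>\<tau>\<in>?L. measure cantor_lebesgue (cylinder (branch_bits P \<tau>)))"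
    by (simp add: finite_measure_finite_Union image_subset_iff)
  then show ?thesis by (simp add: measure_cantor_lebesgue_cylinder)
qed

lemma measure_open_of_equal_length:
  assumes "finite S" "\<And>\<sigma>. \<sigma> \<in> S \<Longrightarrow> length \<sigma> = n"
  shows "measure cantor_lebesgue (open_of S) = card S * (1/2) ^ n"
proof -
  interpret prob_space cantor_lebesgue by (rule prob_space_cantor_lebesgue)
  have "disjoint_family_on cylinder S"
    unfolding disjoint_family_on_def using equal_length_disjoint assms(2) by metis
  then have "measure cantor_lebesgue (open_of S) = (\<Sum>\<sigma>\<in>S. measure cantor_lebesgue (cylinder \<sigma>))"
    unfolding open_of_def using assms(1) by (intro finite_measure_finite_Union) auto
  also have "\<dots> = (\<Sum>\<sigma>\<in>S. (1/2) ^ n)"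
    using assms(2) by (intro sum.cong) (simp_all add: measure_cantor_lebesgue_cylinder)
  finally show ?thesis by simp
qed

text \<open>All cylinders of level \<open>n\<close> have the same measure, which cancels and leaves
  a ratio of cardinalities.\<close>

lemma relative_measure_eq:
  assumes "length \<sigma> \<le> n"
  shows "relative_measure P \<sigma> n = card {\<tau> \<in> level P n. prefix \<sigma> \<tau>} / card (level P n)"
proof -
  have "X \<in> cylinder \<sigma> \<and> \<tau> \<in> level P n \<and> X \<in> cylinder \<tau> \<longleftrightarrow>
      (\<tau> \<in> level P n \<and> prefix \<sigma> \<tau>) \<and> X \<in> cylinder \<tau>" for X \<tau>
  proof (intro iffI; elim conjE; intro conjI; assumption?)
    assume "X \<in> cylinder \<sigma>" "\<tau> \<in> level P n" "X \<in> cylinder \<tau>"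
    then have "initial X (length \<sigma>) = \<sigma>" "initial X n = \<tau>"
      unfolding in_cylinder by (simp_all only: length_level)
    then show "prefix \<sigma> \<tau>" using prefix_initial[OF assms, of X] by simp
  next
    assume "prefix \<sigma> \<tau>" "X \<in> cylinder \<tau>"
    then show "X \<in> cylinder \<sigma>" using cylinder_antimono by blast
  qed
  then have "cylinder \<sigma> \<inter> open_of (level P n) = open_of {\<tau> \<in> level P n. prefix \<sigma> \<tau>}"
    unfolding open_of_def by blast
  moreover have "measure cantor_lebesgue (open_of (level P n)) = card (level P n) * (1/2) ^ n"
    by (rule measure_open_of_equal_length[OF finite_level length_level])
  moreover have "measure cantor_lebesgue (open_of {\<tau> \<in> level P n. prefix \<sigma> \<tau>})
      = card {\<tau> \<in> level P n. prefix \<sigma> \<tau>} * (1/2) ^ n"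
    by (rule measure_open_of_equal_length) (auto simp: length_level)
  ultimately show ?thesis by (simp add: relative_measure_def)
qed

lemma relative_measure_additive:
  "relative_measure P \<sigma> n = relative_measure P (\<sigma> @ [False]) n + relative_measure P (\<sigma> @ [True]) n"
proof -
  interpret prob_space cantor_lebesgue by (rule prob_space_cantor_lebesgue)
  let ?V = "open_of (level P n)"
  have sets: "cylinder \<tau> \<inter> ?V \<in> sets cantor_lebesgue" for \<tau>
    by (intro sets.Int sets_open_of) simp_all
  have "cylinder \<sigma> \<inter> ?V = cylinder (\<sigma> @ [False]) \<inter> ?V \<union> cylinder (\<sigma> @ [True]) \<inter> ?V"
    using cylinder_split[of \<sigma>] by blast
  moreover have disj: "(cylinder (\<sigma> @ [False]) \<inter> ?V) \<inter> (cylinder (\<sigma> @ [True]) \<inter> ?V) = {}"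
    by (auto simp: in_cylinder_snoc)
  ultimately have "measure cantor_lebesgue (cylinder \<sigma> \<inter> ?V)
      = measure cantor_lebesgue (cylinder (\<sigma> @ [False]) \<inter> ?V) + measure cantor_lebesgue (cylinder (\<sigma> @ [True]) \<inter> ?V)"
    by (simp only: finite_measure_Union[OF sets sets disj])
  then show ?thesis by (simp add: relative_measure_def add_divide_distrib)
qed

text \<open>Homogeneity is one-sided here, which loses nothing because \<open>\<sigma>\<close> and
  \<open>\<tau>\<close> may be exchanged.\<close>

locale homogeneous_class =
  fixes P :: "cantor set" and c :: nat
  assumes nonempty: "P \<noteq> {}"
    and homogeneous: "\<sigma> \<in> level P n \<Longrightarrow> \<tau> \<in> level P n \<Longrightarrow>
      length (branch_bits P \<sigma>) \<le> length (branch_bits P \<tau>) + c"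
    and convergent: "\<sigma> \<in> tree_of P \<Longrightarrow> convergent (relative_measure P \<sigma>)"
begin

abbreviation weight :: "str \<Rightarrow> real" where
  "weight \<sigma> \<equiv> (1/2) ^ length (branch_bits P \<sigma>)"

lemma level_nonempty: "level P n \<noteq> {}"
  using nonempty initial_in_tree_of length_initial unfolding level_def by blast

lemma weight_le:
  assumes "\<sigma> \<in> level P n" "\<tau> \<in> level P n"
  shows "weight \<tau> \<le> 2 ^ c * weight \<sigma>"
proof -
  have "weight \<tau> = 2 ^ c * (1/2) ^ (length (branch_bits P \<tau>) + c)"
    by (simp add: power_add power_divide)
  also have "\<dots> \<le> 2 ^ c * weight \<sigma>"
    using homogeneous[OF assms] by (intro mult_left_mono power_decreasing) auto
  finally show ?thesis .
qed

lemma card_level_bounds: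
  assumes "\<tau> \<in> level P n"
  shows "card (level P n) * weight \<tau> \<le> 2 ^ c" and "1 \<le> 2 ^ c * (card (level P n) * weight \<tau>)"
proof -
  have sum: "(\<Sum>\<sigma>\<in>level P n. weight \<sigma>) = 1"
    using sum_branch_weights[OF nonempty, of "[]" n] nonempty by (simp add: tree_of_def)
  have "card (level P n) * weight \<tau> = (\<Sum>\<sigma>\<in>level P n. weight \<tau>)" by simp
  also have "\<dots> \<le> (\<Sum>\<sigma>\<in>level P n. 2 ^ c * weight \<sigma>)" by (intro sum_mono weight_le[OF _ assms])
  also have "\<dots> = 2 ^ c" using sum by (simp add: sum_distrib_left[symmetric])
  finally show "card (level P n) * weight \<tau> \<le> 2 ^ c" .
  have "(\<Sum>\<sigma>\<in>level P n. weight \<sigma>) \<le> (\<Sum>\<sigma>\<in>level P n. 2 ^ c * weight \<tau>)"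
    by (intro sum_mono weight_le[OF assms])
  also have "\<dots> = 2 ^ c * (card (level P n) * weight \<tau>)" by simp
  finally show "1 \<le> 2 ^ c * (card (level P n) * weight \<tau>)" unfolding sum .
qed

text \<open>Each string above \<open>\<sigma>\<close> contributes 1 to the cardinality, which agrees
  with \<open>?L\<close> times its weight up to \<open>2 ^ c\<close>; by
  \<open>sum_branch_weights\<close> these weights collapse to that of \<open>\<sigma>\<close>. The
  bounds do not depend on \<open>n\<close> and so survive in the limit.\<close>

lemma relative_measure_bounds:
  assumes \<sigma>: "\<sigma> \<in> tree_of P" and n: "length \<sigma> \<le> n"
  shows "relative_measure P \<sigma> n \<le> 2 ^ c * weight \<sigma>" and "weight \<sigma> \<le> 2 ^ c * relative_measure P \<sigma> n"
proof -
  let ?K = "{\<tau> \<in> level P n. prefix \<sigma> \<tau>}" and ?L = "real (card (level P n))"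
  have L: "?L > 0" using level_nonempty by (simp add: card_gt_0_iff)
  note sum = sum_branch_weights[OF nonempty \<sigma> n]
  have "real (card ?K) = (\<Sum>\<tau>\<in>?K. 1)" by simp
  also have "\<dots> \<le> (\<Sum>\<tau>\<in>?K. 2 ^ c * (?L * weight \<tau>))"
    by (intro sum_mono card_level_bounds) simp
  also have "\<dots> = 2 ^ c * ?L * weight \<sigma>"
    unfolding sum[symmetric] by (simp add: sum_distrib_left mult_ac)
  finally show "relative_measure P \<sigma> n \<le> 2 ^ c * weight \<sigma>"
    using L n by (simp add: relative_measure_eq field_simps)
  have "?L * weight \<sigma> = (\<Sum>\<tau>\<in>?K. ?L * weight \<tau>)"
    unfolding sum[symmetric] by (simp add: sum_distrib_left)
  also have "\<dots> \<le> (\<Sum>\<tau>\<in>?K. 2 ^ c)"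
    by (intro sum_mono card_level_bounds) simp
  finally show "weight \<sigma> \<le> 2 ^ c * relative_measure P \<sigma> n"
    using L n by (simp add: relative_measure_eq field_simps)
qed

lemma relative_measure_off_tree:
  assumes "\<sigma> \<notin> tree_of P"
  shows "\<forall>\<^sub>F n in sequentially. relative_measure P \<sigma> n = 0"
  using eventually_ge_at_top[of "length \<sigma>"]
proof eventually_elim
  case (elim n)
  have "{\<tau> \<in> level P n. prefix \<sigma> \<tau>} = {}"
    using assms prefix_in_tree_of level_tree_of by blast
  with elim show ?case by (simp add: relative_measure_eq)
qed

lemma relative_measure_tendsto: "relative_measure P \<sigma> \<longlonglongrightarrow> limiting_relative_measure P \<sigma>"
proof -
  have "convergent (relative_measure P \<sigma>)"
  proof (cases "\<sigma> \<in> tree_of P")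
    case False
    from tendsto_eventually[OF relative_measure_off_tree[OF this]] show ?thesis
      by (auto simp: convergent_def)
  qed (rule convergent)
  then show ?thesis unfolding limiting_relative_measure_def by (simp add: convergent_LIMSEQ_iff)
qed

lemma limiting_relative_measure_bounds:
  assumes "\<sigma> \<in> tree_of P"
  shows "limiting_relative_measure P \<sigma> \<le> 2 ^ c * weight \<sigma>"
    and "weight \<sigma> \<le> 2 ^ c * limiting_relative_measure P \<sigma>"
  using relative_measure_bounds[OF assms]
  by (auto intro!: LIMSEQ_le_const2[OF relative_measure_tendsto]
      LIMSEQ_le_const[OF tendsto_mult_left[OF relative_measure_tendsto]] exI[of _ "length \<sigma>"])

lemma limiting_relative_measure_off_tree:
  "\<sigma> \<notin> tree_of P \<Longrightarrow> limiting_relative_measure P \<sigma> = 0"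
  using tendsto_eventually[OF relative_measure_off_tree] relative_measure_tendsto LIMSEQ_unique by blast

sublocale cylinder_mass "limiting_relative_measure P"
proof
  show "0 \<le> limiting_relative_measure P \<sigma>" for \<sigma>
    by (rule LIMSEQ_le_const[OF relative_measure_tendsto]) (auto simp: relative_measure_def)
  have "relative_measure P [] n = 1" for n
    using level_nonempty[of n] by (simp add: relative_measure_eq)
  then have "relative_measure P [] = (\<lambda>n. 1)" by (simp add: fun_eq_iff)
  then show "limiting_relative_measure P [] = 1"
    using relative_measure_tendsto[of "[]"] LIMSEQ_unique[OF tendsto_const] by metis
  show "limiting_relative_measure P \<sigma> = limiting_relative_measure P (\<sigma> @ [False]) +
      limiting_relative_measure P (\<sigma> @ [True])" for \<sigma>
  proof (rule LIMSEQ_unique[OF relative_measure_tendsto])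
    show "relative_measure P \<sigma> \<longlonglongrightarrow> limiting_relative_measure P (\<sigma> @ [False]) +
      limiting_relative_measure P (\<sigma> @ [True])"
      using tendsto_add[OF relative_measure_tendsto[of "\<sigma> @ [False]"] relative_measure_tendsto[of "\<sigma> @ [True]"]]
      unfolding relative_measure_additive[symmetric] .
  qed
qed

lemma sets_limiting_measure [simp]: "cylinder \<sigma> \<in> sets (limiting_measure P)"
  unfolding limiting_measure_def by (rule extend_measure_cylinder(1))

lemma emeasure_limiting_measure:
  "emeasure (limiting_measure P) (cylinder \<sigma>) = ennreal (limiting_relative_measure P \<sigma>)"
  unfolding limiting_measure_def by (rule extend_measure_cylinder(2))

end

lemma homogeneous_classI:
  assumes "P \<noteq> {}" "additively_homogeneous P" "\<forall>\<sigma>\<in>tree_of P. convergent (relative_measure P \<sigma>)"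
  obtains c where "homogeneous_class P c"
proof -
  obtain c where c: "\<And>n \<sigma> \<tau>. \<sigma> \<in> level P n \<Longrightarrow> \<tau> \<in> level P n \<Longrightarrow>
      \<bar>int (theta P \<sigma>) - int (theta P \<tau>)\<bar> \<le> int c"
    using assms(2) unfolding additively_homogeneous_def by blast
  have "homogeneous_class P c"
  proof
    fix \<sigma> \<tau> n assume "\<sigma> \<in> level P n" "\<tau> \<in> level P n"
    with c[OF this] show "length (branch_bits P \<sigma>) \<le> length (branch_bits P \<tau>) + c"
      by (simp add: theta_eq_length_branch_bits level_tree_of)
  qed (use assms in auto)
  then show thesis by (rule that)
qed

subsection \<open>Randomness and production\<close>

lemma recp_ternary:
  assumes "recp A (\<lambda>e. p (pfst (pfst e)) (psnd (pfst e)) (psnd e))" "recf A f" "recf A g" "recf A h"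
  shows "recp A (\<lambda>x. p (f x) (g x) (h x))"
  using recp_comp[OF assms(1) recf_pair[OF recf_pair[OF assms(2,3)] assms(4)]] by simp

lemma uniformly_ce_openI:
  assumes "recp A (\<lambda>e. p (pfst (pfst e)) (psnd (pfst e)) (psnd e))"
  shows "uniformly_ce_open A (\<lambda>n. open_of {\<sigma>. \<exists>s. p n (string_code \<sigma>) s})"
proof -
  have "{prod_encode (n, string_code \<sigma>) | n \<sigma>. \<sigma> \<in> {\<sigma>. \<exists>s. p n (string_code \<sigma>) s}}
      = {x. \<exists>s. p (pfst x) (psnd x) s}" (is "?l = ?r")
  proof (intro equalityI subsetI)
    fix x assume "x \<in> ?r"
    then have "\<exists>s. p (pfst x) (string_code (str_of (psnd x))) s" by simp
    moreover have "x = prod_encode (pfst x, string_code (str_of (psnd x)))" by simp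
    ultimately show "x \<in> ?l" by blast
  qed auto
  with ce_in_stages[OF assms] show ?thesis
    unfolding uniformly_ce_open_def by (intro exI[of _ "\<lambda>n. {\<sigma>. \<exists>s. p n (string_code \<sigma>) s}"]) simp
qed

text \<open>From here on a test is a decidable predicate \<open>p\<close> of the component, the code
  of a string and a stage; injectivity of the codes recovers each component from the single
  enumerated set.\<close>

lemma uniformly_ce_openE:
  assumes "uniformly_ce_open A \<U>"
  obtains p where "recp A (\<lambda>e. p (pfst (pfst e)) (psnd (pfst e)) (psnd e))"
    "\<And>n. \<U> n = open_of {\<sigma>. \<exists>s. p n (string_code \<sigma>) s}"
    "\<And>n x s t. p n x s \<Longrightarrow> s \<le> t \<Longrightarrow> p n x t"
proof -
  from assms obtain S where S: "ce_in A {prod_encode (n, string_code \<sigma>) | n \<sigma>. \<sigma> \<in> S n}"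
    and \<U>: "\<And>n. \<U> n = open_of (S n)"
    by (auto simp: uniformly_ce_open_def)
  obtain q where q: "recp A (\<lambda>e. q (pfst e) (psnd e))"
    "\<And>x. x \<in> {prod_encode (n, string_code \<sigma>) | n \<sigma>. \<sigma> \<in> S n} \<longleftrightarrow> (\<exists>s. q x s)"
    "\<And>x s t. q x s \<Longrightarrow> s \<le> t \<Longrightarrow> q x t"
    by (rule ce_in_stagesE[OF S]) (rule that)
  have S_eq: "S n = {\<sigma>. \<exists>s. q (prod_encode (n, string_code \<sigma>)) s}" for n
  proof (intro equalityI subsetI)
    fix \<sigma> assume "\<sigma> \<in> {\<sigma>. \<exists>s. q (prod_encode (n, string_code \<sigma>)) s}"
    then obtain m \<tau> where "prod_encode (n, string_code \<sigma>) = prod_encode (m, string_code \<tau>)" "\<tau> \<in> S m"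
      using q(2)[of "prod_encode (n, string_code \<sigma>)"] by blast
    then show "\<sigma> \<in> S n" using inj_string_code by (simp add: prod_encode_eq inj_eq)
  next
    fix \<sigma> assume "\<sigma> \<in> S n"
    then show "\<sigma> \<in> {\<sigma>. \<exists>s. q (prod_encode (n, string_code \<sigma>)) s}"
      using q(2)[of "prod_encode (n, string_code \<sigma>)"] by blast
  qed
  show thesis
  proof
    show "recp A (\<lambda>e. (\<lambda>n x s. q (prod_encode (n, x)) s) (pfst (pfst e)) (psnd (pfst e)) (psnd e))"
      using q(1) by simp
    show "\<U> n = open_of {\<sigma>. \<exists>s. q (prod_encode (n, string_code \<sigma>)) s}" for n
      unfolding \<U> S_eq ..
  qed (rule q(3))
qed

lemma machine_complexity_lessD:
  assumes "ereal_of_enat (machine_complexity M \<sigma>) < ereal r"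
  shows "\<exists>\<tau>. M \<tau> = Some \<sigma> \<and> real (length \<tau>) < r"
proof -
  from assms obtain k where k: "machine_complexity M \<sigma> = enat k"
    by (cases "machine_complexity M \<sigma>") auto
  then have "machine_complexity M \<sigma> < enat (Suc k)" by simp
  then obtain \<tau> where "M \<tau> = Some \<sigma>" "length \<tau> < Suc k"
    unfolding machine_complexity_def INF_less_iff by auto
  with assms k show ?thesis by (intro exI[of _ \<tau>]) auto
qed

lemma machine_complexity_le: "M \<tau> = Some \<sigma> \<Longrightarrow> machine_complexity M \<sigma> \<le> enat (length \<tau>)"
  unfolding machine_complexity_def by (rule INF_lower) simp

text \<open>The strings of bits read along \<open>X\<close> form a chain. If their lengths are
  unbounded, the chain is the set of prefixes of one \<open>R\<close>; otherwise it has a longest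
  member, and every extension of that member produces \<open>X\<close>.\<close>

lemma branch_pathE:
  assumes "X \<in> P"
  obtains (unbounded) R where "\<And>m. R \<in> cylinder (branch_bits P (initial X m))"
      "\<And>k. \<exists>m. k \<le> length (branch_bits P (initial X m))"
  | (bounded) \<sigma> where "\<And>R m. R \<in> cylinder \<sigma> \<Longrightarrow> R \<in> cylinder (branch_bits P (initial X m))"
proof (cases "\<forall>k. \<exists>m. k \<le> length (branch_bits P (initial X m))")
  case True
  define b where "b m = branch_bits P (initial X m)" for m
  have comparable: "prefix (b m) (b n) \<or> prefix (b n) (b m)" for m n
    unfolding b_def using prefix_branch_bits[OF prefix_initial] nat_le_linear[of m n] by blast
  have nth_eq: "b m ! j = b n ! j" if "j < length (b m)" "j < length (b n)" for m n j
    using comparable[of m n] that by (auto simp: prefix_def nth_append)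
  have "\<exists>m. j < length (b m)" for j
    using True[rule_format, of "Suc j"] by (simp add: b_def Suc_le_eq)
  then obtain M where M: "\<And>j. j < length (b (M j))" by metis
  show ?thesis
  proof (rule unbounded)
    show "(\<lambda>j. b (M j) ! j) \<in> cylinder (branch_bits P (initial X m))" for m
      using nth_eq[OF M] unfolding in_cylinder_nth by (simp add: b_def)
  qed (use True in blast)
next
  case False
  then obtain k where "\<And>m. length (branch_bits P (initial X m)) < k" by (auto simp: not_le)
  then have "\<exists>m. \<forall>n. length (branch_bits P (initial X n)) \<le> length (branch_bits P (initial X m))"
    using ex_has_greatest_nat[of "\<lambda>_. True" 0 "\<lambda>m. length (branch_bits P (initial X m))" k] by auto
  then obtain m where m: "\<And>n. length (branch_bits P (initial X n)) \<le> length (branch_bits P (initial X m))"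
    by blast
  show ?thesis
  proof (rule bounded)
    fix R n assume R: "R \<in> cylinder (branch_bits P (initial X m))"
    have "prefix (branch_bits P (initial X n)) (branch_bits P (initial X m))"
    proof (cases "n \<le> m")
      case False
      then have "prefix (branch_bits P (initial X m)) (branch_bits P (initial X n))"
        by (intro prefix_branch_bits prefix_initial) simp
      with m[of n] have "branch_bits P (initial X n) = branch_bits P (initial X m)"
        by (auto simp: prefix_def)
      then show ?thesis by simp
    qed (intro prefix_branch_bits prefix_initial)
    then show "R \<in> cylinder (branch_bits P (initial X n))"
      using cylinder_antimono R by blast
  qed
qed

context homogeneous_class
begin

lemma limiting_measure_le:
  "emeasure (limiting_measure P) (cylinder \<sigma>) \<le> ennreal (2 ^ c) * emeasure cantor_lebesgue (cylinder (branch_bits P \<sigma>))"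
proof (cases "\<sigma> \<in> tree_of P")
  case True
  then show ?thesis
    using limiting_relative_measure_bounds(1)[OF True]
    by (simp add: emeasure_limiting_measure emeasure_cantor_lebesgue_cylinder ennreal_mult'[symmetric])
qed (simp add: emeasure_limiting_measure limiting_relative_measure_off_tree)

lemma le_limiting_measure:
  assumes "\<sigma> \<in> tree_of P"
  shows "emeasure cantor_lebesgue (cylinder (branch_bits P \<sigma>)) \<le> ennreal (2 ^ c) * emeasure (limiting_measure P) (cylinder \<sigma>)"
  using limiting_relative_measure_bounds(2)[OF assms]
  by (simp add: emeasure_limiting_measure emeasure_cantor_lebesgue_cylinder ennreal_mult'[symmetric] ennreal_leI)

text \<open>Skipping the first \<open>c\<close> components of a test pays for the factor
  \<open>2 ^ c\<close> between the two measures.\<close>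

lemma test_shift:
  assumes "a \<le> ennreal (2 ^ c) * b" "b \<le> ennreal ((1/2) ^ (n + c))"
  shows "a \<le> ennreal ((1/2) ^ n)"
proof -
  have "a \<le> ennreal (2 ^ c) * ennreal ((1/2) ^ (n + c))"
    using assms(1) by (rule order_trans) (intro mult_left_mono assms(2), simp)
  also have "\<dots> = ennreal ((1/2) ^ n)"
    by (simp add: ennreal_mult'[symmetric] power_add power_divide)
  finally show ?thesis .
qed

text \<open>A test capturing \<open>X\<close> is pushed forward: \<open>W n\<close> consists of the
  bits of those tree strings that are enumerated into component \<open>n + c\<close>. The path lies
  in such a cylinder only if \<open>R\<close> extends the corresponding bits.\<close>

lemma randomly_produced_imp_globally_random:
  assumes "randomly_produced P X"
  shows "globally_random P X"
proof -
  let ?A = "tree_oracle P" and ?N = "limiting_measure P"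
  obtain R where R: "R \<in> MLR ?A cantor_lebesgue" and X: "X = Psi P R"
    using assms by (auto simp: randomly_produced_def)
  have "X \<notin> (\<Inter>n. \<U> n)" if test: "uniformly_ce_open ?A \<U>" and small: "\<forall>n. emeasure ?N (\<U> n) \<le> ennreal ((1/2) ^ n)" for \<U>
  proof
    assume XU: "X \<in> (\<Inter>n. \<U> n)"
    obtain p where p: "recp ?A (\<lambda>e. p (pfst (pfst e)) (psnd (pfst e)) (psnd e))"
      and \<U>: "\<And>n. \<U> n = open_of {\<sigma>. \<exists>s. p n (string_code \<sigma>) s}"
      by (rule uniformly_ce_openE[OF test]) (rule that)
    \<comment> \<open>The stage \<open>s\<close> codes a pair, the preimage \<open>\<sigma>\<close>
      together with its stage of enumeration, so that the existential quantifier over preimages is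
      absorbed by the stage.\<close>
    define q where "q n r s \<longleftrightarrow> str_of (pfst s) \<in> tree_of P \<and> p (n + c) (pfst s) (psnd s) \<and>
      string_code (branch_bits P (str_of (pfst s))) = r" for n r s
    define W where "W n = {\<rho>. \<exists>s. q n (string_code \<rho>) s}" for n
    have W: "\<rho> \<in> W n \<longleftrightarrow> (\<exists>\<sigma>\<in>tree_of P. (\<exists>s. p (n + c) (string_code \<sigma>) s) \<and> branch_bits P \<sigma> = \<rho>)" for \<rho> n
    proof
      assume "\<rho> \<in> W n"
      then obtain s where "q n (string_code \<rho>) s" unfolding W_def by blast
      then show "\<exists>\<sigma>\<in>tree_of P. (\<exists>s. p (n + c) (string_code \<sigma>) s) \<and> branch_bits P \<sigma> = \<rho>"
        using inj_string_code unfolding q_def by (intro bexI[of _ "str_of (pfst s)"]) (auto simp: inj_eq)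
    next
      assume "\<exists>\<sigma>\<in>tree_of P. (\<exists>s. p (n + c) (string_code \<sigma>) s) \<and> branch_bits P \<sigma> = \<rho>"
      then obtain \<sigma> s where "\<sigma> \<in> tree_of P" "p (n + c) (string_code \<sigma>) s" "branch_bits P \<sigma> = \<rho>" by blast
      then have "q n (string_code \<rho>) (prod_encode (string_code \<sigma>, s))" by (simp add: q_def)
      then show "\<rho> \<in> W n" unfolding W_def by blast
    qed
    have "recp ?A (\<lambda>e. q (pfst (pfst e)) (psnd (pfst e)) (psnd e))"
      unfolding q_def by (intro rec_intros recp_ternary[OF p])
    then have "uniformly_ce_open ?A (\<lambda>n. open_of (W n))"
      unfolding W_def by (rule uniformly_ce_openI)
    moreover have "emeasure cantor_lebesgue (open_of (W n)) \<le> ennreal ((1/2) ^ n)" for n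
    proof (rule test_shift)
      \<comment> \<open>One preimage is chosen for each bit string. Comparable preimages have
        comparable bits, as \<open>branch_bits\<close> is monotone; this is the disjointness
        condition required of \<open>g\<close>.\<close>
      obtain g where g: "\<And>\<rho>. \<rho> \<in> W n \<Longrightarrow> g \<rho> \<in> tree_of P \<and> (\<exists>s. p (n + c) (string_code (g \<rho>)) s) \<and> branch_bits P (g \<rho>) = \<rho>"
        using W[of _ n] by metis
      show "emeasure cantor_lebesgue (open_of (W n)) \<le> ennreal (2 ^ c) * emeasure ?N (\<U> (n + c))"
      proof (rule emeasure_open_of_le)
        show "\<U> (n + c) \<in> sets ?N" unfolding \<U> by (rule sets_open_of) simp
        fix \<rho> assume \<rho>: "\<rho> \<in> W n"
        show "cylinder (g \<rho>) \<subseteq> \<U> (n + c)"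
          unfolding \<U> open_of_def using g[OF \<rho>] by blast
        show "emeasure cantor_lebesgue (cylinder \<rho>) \<le> ennreal (2 ^ c) * emeasure ?N (cylinder (g \<rho>))"
          using le_limiting_measure[of "g \<rho>"] g[OF \<rho>] by simp
        fix \<rho>' assume \<rho>': "\<rho>' \<in> W n" and "cylinder (g \<rho>) \<inter> cylinder (g \<rho>') \<noteq> {}"
        then have "prefix (g \<rho>) (g \<rho>') \<or> prefix (g \<rho>') (g \<rho>)" using cylinder_comparable by blast
        then have "prefix \<rho> \<rho>' \<or> prefix \<rho>' \<rho>" using g[OF \<rho>] g[OF \<rho>'] prefix_branch_bits by metis
        then show "cylinder \<rho> \<inter> cylinder \<rho>' \<noteq> {}"
          using cylinder_antimono cylinder_nonempty[of \<rho>] cylinder_nonempty[of \<rho>'] by blast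
      qed simp_all
    qed (use small in blast)
    ultimately have "R \<notin> (\<Inter>n. open_of (W n))" using R unfolding MLR_def by blast
    moreover have "R \<in> open_of (W n)" for n
    proof -
      have "Psi P R \<in> \<U> (n + c)" using XU X by blast
      then obtain \<sigma> s where "p (n + c) (string_code \<sigma>) s" "Psi P R \<in> cylinder \<sigma>"
        unfolding \<U> in_open_of by blast
      then show ?thesis
        using Psi_in_cylinder[OF nonempty] W unfolding in_open_of by blast
    qed
    ultimately show False by blast
  qed
  then show ?thesis unfolding globally_random_def MLR_def by blast
qed

text \<open>If the bits read along \<open>X\<close> are bounded, any random \<open>R\<close>
  extending them will do. If not, \<open>R\<close> is determined by \<open>X\<close>, and a test
  capturing it is pulled back along \<open>branch_bits\<close> to one capturing
  \<open>X\<close>.\<close>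

lemma globally_random_imp_randomly_produced:
  assumes "X \<in> P" "globally_random P X"
  shows "randomly_produced P X"
proof -
  let ?A = "tree_oracle P" and ?N = "limiting_measure P"
  have "\<exists>R\<in>MLR ?A cantor_lebesgue. \<forall>m. R \<in> cylinder (branch_bits P (initial X m))"
    using assms(1)
  proof (cases rule: branch_pathE)
    case (bounded \<sigma>)
    obtain R where "R \<in> MLR ?A cantor_lebesgue" "R \<in> cylinder \<sigma>"
      using MLR_meets_cylinder[of cantor_lebesgue \<sigma> ?A]
      by (auto simp: emeasure_cantor_lebesgue_cylinder)
    with bounded show ?thesis by blast
  next
    case (unbounded R)
    have "R \<notin> (\<Inter>n. \<V> n)" if test: "uniformly_ce_open ?A \<V>" and small: "\<forall>n. emeasure cantor_lebesgue (\<V> n) \<le> ennreal ((1/2) ^ n)" for \<V>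
    proof
      assume RV: "R \<in> (\<Inter>n. \<V> n)"
      obtain p where p: "recp ?A (\<lambda>e. p (pfst (pfst e)) (psnd (pfst e)) (psnd e))"
        and \<V>: "\<And>n. \<V> n = open_of {\<sigma>. \<exists>s. p n (string_code \<sigma>) s}"
        by (rule uniformly_ce_openE[OF test]) (rule that)
      \<comment> \<open>A node enters as soon as some prefix of its bits is enumerated, so any node
        of \<open>X\<close> with enough bits will serve below. The detour through
        \<open>str_of\<close> and \<open>string_code\<close> gives the term the shape of
        \<open>recf_take\<close>.\<close>
      define q where "q n x s \<longleftrightarrow> str_of x \<in> tree_of P \<and>
        p (n + c) (string_code (take (pfst s) (str_of (string_code (branch_bits P (str_of x)))))) (psnd s)" for n x s
      define W where "W n = {\<sigma>. \<exists>s. q n (string_code \<sigma>) s}" for n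
      have W: "\<sigma> \<in> W n \<longleftrightarrow> \<sigma> \<in> tree_of P \<and> (\<exists>k s. p (n + c) (string_code (take k (branch_bits P \<sigma>))) s)" for \<sigma> n
      proof
        assume "\<sigma> \<in> W n"
        then show "\<sigma> \<in> tree_of P \<and> (\<exists>k s. p (n + c) (string_code (take k (branch_bits P \<sigma>))) s)"
          unfolding W_def q_def by auto
      next
        assume "\<sigma> \<in> tree_of P \<and> (\<exists>k s. p (n + c) (string_code (take k (branch_bits P \<sigma>))) s)"
        then obtain k s where "\<sigma> \<in> tree_of P" "p (n + c) (string_code (take k (branch_bits P \<sigma>))) s" by blast
        then have "q n (string_code \<sigma>) (prod_encode (k, s))" by (simp add: q_def)
        then show "\<sigma> \<in> W n" unfolding W_def by blast
      qed
      have "recp ?A (\<lambda>e. q (pfst (pfst e)) (psnd (pfst e)) (psnd e))"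
        unfolding q_def by (intro rec_intros recp_ternary[OF p])
      then have "uniformly_ce_open ?A (\<lambda>n. open_of (W n))"
        unfolding W_def by (rule uniformly_ce_openI)
      moreover have "emeasure ?N (open_of (W n)) \<le> ennreal ((1/2) ^ n)" for n
      proof (rule test_shift)
        show "emeasure ?N (open_of (W n)) \<le> ennreal (2 ^ c) * emeasure cantor_lebesgue (\<V> (n + c))"
        proof (rule emeasure_open_of_le)
          show "\<V> (n + c) \<in> sets cantor_lebesgue" unfolding \<V> by (rule sets_open_of) simp
          fix \<sigma> assume \<sigma>: "\<sigma> \<in> W n"
          then obtain k s where "p (n + c) (string_code (take k (branch_bits P \<sigma>))) s" unfolding W by blast
          then have "cylinder (take k (branch_bits P \<sigma>)) \<subseteq> \<V> (n + c)" unfolding \<V> open_of_def by blast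
          with cylinder_antimono[OF take_is_prefix] show "cylinder (branch_bits P \<sigma>) \<subseteq> \<V> (n + c)" by blast
          show "emeasure ?N (cylinder \<sigma>) \<le> ennreal (2 ^ c) * emeasure cantor_lebesgue (cylinder (branch_bits P \<sigma>))"
            by (rule limiting_measure_le)
          fix \<tau> assume "\<tau> \<in> W n" "cylinder (branch_bits P \<sigma>) \<inter> cylinder (branch_bits P \<tau>) \<noteq> {}"
          with \<sigma> show "cylinder \<sigma> \<inter> cylinder \<tau> \<noteq> {}"
            using branch_bits_disjoint[OF nonempty] unfolding W by blast
        qed simp_all
      qed (use small in blast)
      ultimately have "X \<notin> (\<Inter>n. open_of (W n))"
        using assms(2) unfolding globally_random_def MLR_def by blast
      moreover have "X \<in> open_of (W n)" for n
      proof -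
        have "R \<in> \<V> (n + c)" using RV by blast
        then obtain \<tau> s where \<tau>: "p (n + c) (string_code \<tau>) s" "R \<in> cylinder \<tau>"
          unfolding \<V> in_open_of by blast
        obtain m where m: "length \<tau> \<le> length (branch_bits P (initial X m))" using unbounded(2) by blast
        have "take (length \<tau>) (branch_bits P (initial X m)) = \<tau>"
          using \<tau>(2) unbounded(1)[of m] take_initial[OF m, of R] unfolding in_cylinder by simp
        then have "initial X m \<in> W n"
          using \<tau>(1) initial_in_tree_of[OF assms(1)] unfolding W by metis
        then show ?thesis unfolding in_open_of using in_cylinder_initial by blast
      qed
      ultimately show False by blast
    qed
    then have "R \<in> MLR ?A cantor_lebesgue" unfolding MLR_def by blast
    with unbounded(1) show ?thesis by blast
  qed
  then show ?thesis
    unfolding randomly_produced_def using Psi_eqI[OF assms(1)] by blast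
qed

text \<open>This exchanges the level size in the definition of incompressibility for the number of
  branching nodes; one bound serves each direction.\<close>

lemma log_card_level_bounds:
  assumes "\<tau> \<in> level P n"
  shows "log 2 (card (level P n)) \<le> length (branch_bits P \<tau>) + c"
    and "length (branch_bits P \<tau>) \<le> log 2 (card (level P n)) + c"
proof -
  let ?L = "real (card (level P n))" and ?b = "length (branch_bits P \<tau>)"
  have L: "?L > 0" using level_nonempty by (simp add: card_gt_0_iff)
  have le: "?L \<le> 2 ^ (?b + c)" "2 ^ ?b \<le> 2 ^ c * ?L"
    using card_level_bounds[OF assms] by (simp_all add: power_divide field_simps power_add)
  have "log 2 ?L \<le> log 2 (2 ^ (?b + c))"
    using L le(1) by (intro log_mono) simp_all
  then show "log 2 ?L \<le> ?b + c" by (simp add: log_nat_power)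
  have "log 2 (2 ^ ?b) \<le> log 2 (2 ^ c * ?L)"
    using le(2) by (intro log_mono) simp_all
  also have "\<dots> = log 2 (2 ^ c) + log 2 ?L"
    using L by (simp add: log_mult_pos)
  finally show "?b \<le> log 2 ?L + c" by (simp add: log_nat_power)
qed

text \<open>\<open>W n\<close> collects the strings with a program at least \<open>n + c\<close>
  bits shorter than their number of branching nodes. Prefix-freeness makes the cylinders of such
  programs disjoint, so Lebesgue measure bounds their total weight by 1, and the saved bits make the
  measure of \<open>W n\<close> small.\<close>

lemma globally_random_imp_incompressible:
  assumes X: "X \<in> P" "globally_random P X" and U: "prefix_free_machine (tree_oracle P) U"
  shows "incompressible U P X"
proof (rule ccontr)
  assume compressible: "\<not> incompressible U P X"
  let ?A = "tree_oracle P" and ?N = "limiting_measure P"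
  obtain f where "partrec ?A f" and f: "\<And>\<sigma>. f (string_code \<sigma>) = map_option string_code (U \<sigma>)"
    using U unfolding prefix_free_machine_def by auto
  then obtain F where F: "recf ?A (\<lambda>e. F (pfst e) (psnd e))" "staged f F"
    using partrec_staged[of ?A f] by auto
  have pf: "\<sigma> = \<tau>" if "U \<sigma> = Some x" "U \<tau> = Some y" "prefix \<sigma> \<tau>" for \<sigma> \<tau> x y
    using U that domI[of U] unfolding prefix_free_machine_def by auto
  have U_F: "U \<tau> = Some \<sigma> \<longleftrightarrow> (\<exists>s. F (string_code \<tau>) s = Suc (string_code \<sigma>))" for \<sigma> \<tau>
  proof -
    have "U \<tau> = Some \<sigma> \<longleftrightarrow> f (string_code \<tau>) = Some (string_code \<sigma>)"
      unfolding f using inj_string_code by (cases "U \<tau>") (auto simp: inj_eq)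
    then show ?thesis using staged_Some[OF F(2)] by simp
  qed
  define q where "q n x s \<longleftrightarrow> str_of x \<in> tree_of P \<and> F (pfst s) (psnd s) = Suc x \<and>
    length (str_of (pfst s)) + n + c \<le> length (branch_bits P (str_of x))" for n x s
  define W where "W n = {\<sigma>. \<exists>s. q n (string_code \<sigma>) s}" for n
  have W: "\<sigma> \<in> W n \<longleftrightarrow> \<sigma> \<in> tree_of P \<and> (\<exists>\<tau>. U \<tau> = Some \<sigma> \<and> length \<tau> + n + c \<le> length (branch_bits P \<sigma>))" for \<sigma> n
  proof
    assume "\<sigma> \<in> W n"
    then obtain s where "q n (string_code \<sigma>) s" unfolding W_def by blast
    then show "\<sigma> \<in> tree_of P \<and> (\<exists>\<tau>. U \<tau> = Some \<sigma> \<and> length \<tau> + n + c \<le> length (branch_bits P \<sigma>))"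
      unfolding q_def U_F by (auto intro!: exI[of _ "str_of (pfst s)"])
  next
    assume "\<sigma> \<in> tree_of P \<and> (\<exists>\<tau>. U \<tau> = Some \<sigma> \<and> length \<tau> + n + c \<le> length (branch_bits P \<sigma>))"
    then obtain \<tau> s where "\<sigma> \<in> tree_of P" "F (string_code \<tau>) s = Suc (string_code \<sigma>)"
      "length \<tau> + n + c \<le> length (branch_bits P \<sigma>)" unfolding U_F by blast
    then have "q n (string_code \<sigma>) (prod_encode (string_code \<tau>, s))" by (simp add: q_def)
    then show "\<sigma> \<in> W n" unfolding W_def by blast
  qed
  have "recp ?A (\<lambda>e. q (pfst (pfst e)) (psnd (pfst e)) (psnd e))"
    unfolding q_def by (intro rec_intros recf_binary[OF F(1)])
  then have "uniformly_ce_open ?A (\<lambda>n. open_of (W n))"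
    unfolding W_def by (rule uniformly_ce_openI)
  moreover have "emeasure ?N (open_of (W n)) \<le> ennreal ((1/2) ^ n)" for n
  proof -
    obtain g where g: "\<And>\<sigma>. \<sigma> \<in> W n \<Longrightarrow> U (g \<sigma>) = Some \<sigma> \<and> length (g \<sigma>) + n + c \<le> length (branch_bits P \<sigma>)"
      using W[of _ n] by metis
    \<comment> \<open>The cylinder of the empty string is the whole space, which makes this Kraft's
      inequality for the chosen programs. Of the \<open>n + c\<close> saved bits, \<open>c\<close>
      cancel the factor \<open>2 ^ c\<close> in the bound on the limiting measure.\<close>
    have "emeasure ?N (open_of (W n)) \<le> ennreal ((1/2) ^ n) * emeasure cantor_lebesgue (cylinder [])"
    proof (rule emeasure_open_of_le)
      fix \<sigma> assume \<sigma>: "\<sigma> \<in> W n"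
      have "limiting_relative_measure P \<sigma> \<le> 2 ^ c * weight \<sigma>"
        using limiting_relative_measure_bounds(1) \<sigma> W by blast
      also have "\<dots> \<le> 2 ^ c * (1/2) ^ (length (g \<sigma>) + n + c)"
        using g[OF \<sigma>] by (intro mult_left_mono power_decreasing) auto
      also have "\<dots> = (1/2) ^ n * (1/2) ^ length (g \<sigma>)"
        by (simp add: power_add power_divide)
      finally show "emeasure ?N (cylinder \<sigma>) \<le> ennreal ((1/2) ^ n) * emeasure cantor_lebesgue (cylinder (g \<sigma>))"
        by (simp add: emeasure_limiting_measure emeasure_cantor_lebesgue_cylinder ennreal_mult'[symmetric] ennreal_leI)
      fix \<tau> assume \<tau>: "\<tau> \<in> W n" and "cylinder (g \<sigma>) \<inter> cylinder (g \<tau>) \<noteq> {}"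
      then have "prefix (g \<sigma>) (g \<tau>) \<or> prefix (g \<tau>) (g \<sigma>)" using cylinder_comparable by blast
      moreover have "U (g \<sigma>) = Some \<sigma>" "U (g \<tau>) = Some \<tau>" using g \<sigma> \<tau> by blast+
      ultimately have "g \<sigma> = g \<tau>" by (elim disjE) (rule pf, assumption+, rule sym, rule pf)
      have "Some \<sigma> = U (g \<sigma>)" by (rule sym) fact
      also have "\<dots> = U (g \<tau>)" by (rule arg_cong) fact
      also have "\<dots> = Some \<tau>" by fact
      finally have "\<sigma> = \<tau>" by (rule option.inject[THEN iffD1])
      then show "cylinder \<sigma> \<inter> cylinder \<tau> \<noteq> {}" using cylinder_nonempty by simp
    qed (use sets_cantor_lebesgue_cylinder[of "[]"] in simp_all)
    then show ?thesis by (simp only: emeasure_cantor_lebesgue_cylinder) simp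
  qed
  ultimately have "X \<notin> (\<Inter>n. open_of (W n))"
    using X(2) unfolding globally_random_def MLR_def by blast
  moreover have "X \<in> open_of (W n)" for n
  proof -
    \<comment> \<open>The constant \<open>n + 2 * c\<close>: one \<open>c\<close> is lost between
      the logarithm and the number of branching nodes, and membership in \<open>W n\<close> asks for
      \<open>n + c\<close>.\<close>
    have "\<exists>m. \<not> ereal (log 2 (card (level P m)) - real (n + 2 * c)) \<le> ereal_of_enat (machine_complexity U (initial X m))"
    proof (rule ccontr)
      assume "\<nexists>m. \<not> ereal (log 2 (card (level P m)) - real (n + 2 * c)) \<le> ereal_of_enat (machine_complexity U (initial X m))"
      then have "incompressible U P X"
        unfolding incompressible_def by (intro exI[of _ "real (n + 2 * c)"]) simp
      with compressible show False ..
    qed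
    then obtain m where "ereal_of_enat (machine_complexity U (initial X m)) < ereal (log 2 (card (level P m)) - real (n + 2 * c))"
      by (auto simp: not_le)
    from machine_complexity_lessD[OF this] obtain \<tau> where
      \<tau>: "U \<tau> = Some (initial X m)" "length \<tau> < log 2 (card (level P m)) - real (n + 2 * c)" by blast
    have m: "initial X m \<in> level P m" using initial_in_tree_of[OF X(1)] by (simp add: level_def)
    from log_card_level_bounds(1)[OF m] \<tau>(2) have "length \<tau> + n + c \<le> length (branch_bits P (initial X m))"
      by linarith
    with \<tau>(1) level_tree_of[OF m] have "initial X m \<in> W n" unfolding W by blast
    then show ?thesis unfolding in_open_of using in_cylinder_initial by blast
  qed
  ultimately show False by blast
qed

end

subsection \<open>The Kraft-Chaitin theorem\<close>

text \<open>\<open>string_code \<sigma> + 1\<close> is \<open>2 ^ length \<sigma>\<close> plus the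
  binary value of \<open>\<sigma>\<close>; hence this is the left end of the dyadic subinterval of
  the unit interval that belongs to \<open>\<sigma>\<close>.\<close>

definition left_endpoint :: "str \<Rightarrow> real" where
  "left_endpoint \<sigma> = (string_code \<sigma> + 1) / 2 ^ length \<sigma> - 1"

lemma left_endpoint_snoc:
  "left_endpoint (\<sigma> @ [b]) = left_endpoint \<sigma> + (if b then (1/2) ^ Suc (length \<sigma>) else 0)"
  by (simp add: left_endpoint_def field_simps)

lemma left_endpoint_prefix:
  assumes "prefix \<sigma> \<tau>"
  shows "left_endpoint \<sigma> \<le> left_endpoint \<tau>"
    and "left_endpoint \<tau> + (1/2) ^ length \<tau> \<le> left_endpoint \<sigma> + (1/2) ^ length \<sigma>"
proof -
  have "left_endpoint \<sigma> \<le> left_endpoint \<tau> \<and>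
      left_endpoint \<tau> + (1/2) ^ length \<tau> \<le> left_endpoint \<sigma> + (1/2) ^ length \<sigma>"
    using assms
  proof (induction \<tau> rule: rev_induct)
    case (snoc b \<tau>)
    show ?case
    proof (cases "\<sigma> = \<tau> @ [b]")
      case False
      with snoc.prems have "prefix \<sigma> \<tau>" by (simp add: prefix_snoc)
      note IH = snoc.IH[OF this]
      define x :: real where "x = (1/2) ^ length \<tau>"
      have "0 < x" "(1/2) ^ Suc (length \<tau>) = x / 2" by (simp_all add: x_def)
      with IH show ?thesis
        unfolding left_endpoint_snoc x_def[symmetric] length_append_singleton by auto
    qed simp
  qed simp
  then show "left_endpoint \<sigma> \<le> left_endpoint \<tau>"
    "left_endpoint \<tau> + (1/2) ^ length \<tau> \<le> left_endpoint \<sigma> + (1/2) ^ length \<sigma>" by blast+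
qed

lemma length_eqI:
  assumes "2 ^ l \<le> string_code \<sigma> + 1" "string_code \<sigma> + 1 < 2 ^ Suc l"
  shows "length \<sigma> = l"
proof -
  have lt: "(2::nat) ^ length \<sigma> < 2 ^ Suc l" "(2::nat) ^ l < 2 ^ Suc (length \<sigma>)"
    using string_code_bounds[of \<sigma>] assms by linarith+
  have "length \<sigma> < Suc l" "l < Suc (length \<sigma>)"
    by (rule power_less_imp_less_exp[OF _ lt(1)], simp, rule power_less_imp_less_exp[OF _ lt(2)], simp)
  then show ?thesis by simp
qed

text \<open>
  The \<open>i\<close>-th request owns the interval of length \<open>2\<^sup>-\<^sup>d\<close>, \<open>d = d i\<close>, that starts at the sum of the
  earlier weights. Its codeword is a dyadic interval of half that length inside it, so no alignment
  of the requests is needed.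
\<close>

lemma kraft_chaitin:
  fixes active :: "nat \<Rightarrow> bool" and d out :: "nat \<Rightarrow> nat"
  assumes rec: "recp A active" "recf A d" "recf A out"
    and kraft: "\<And>n. (\<Sum>i<n. if active i then (1/2) ^ d i else 0) \<le> (1 :: real)"
  obtains M where "prefix_free_machine A M"
    "\<And>i. active i \<Longrightarrow> \<exists>\<tau>. M \<tau> = Some (str_of (out i)) \<and> length \<tau> = Suc (d i)"
proof -
  define a :: "nat \<Rightarrow> real" where "a n = (\<Sum>i<n. if active i then (1/2) ^ d i else 0)" for n
  \<comment> \<open>The partial sum \<open>a n\<close> is a dyadic rational with denominator
    \<open>2 ^ L n\<close> and numerator \<open>N n\<close>, so comparisons with it are decidable
    over the naturals.\<close>
  define L where "L n = (\<Sum>i<n. d i)" for n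
  define N :: "nat \<Rightarrow> nat" where "N n = rec_nat 0 (\<lambda>i v. v * 2 ^ d i + (if active i then 2 ^ L i else 0)) n" for n
  have N: "real (N n) = a n * 2 ^ L n" for n
  proof (induction n)
    case (Suc n)
    have "real (N (Suc n)) = real (N n) * 2 ^ d n + (if active n then 2 ^ L n else 0)"
      by (simp add: N_def)
    also have "\<dots> = a (Suc n) * 2 ^ L (Suc n)"
      unfolding Suc by (simp add: a_def L_def power_add power_divide field_simps)
    finally show ?case .
  qed (simp add: N_def a_def)
  \<comment> \<open>The last two conditions place the left endpoint in the first half of the
    interval of request \<open>i\<close>; they are multiplied by
    \<open>2 ^ Suc (d i) * 2 ^ L i\<close>, with the \<open>- 1\<close> of
    \<open>left_endpoint\<close> moved across.\<close>
  define Q where "Q c i \<longleftrightarrow> active i \<and> length (str_of c) = Suc (d i) \<and>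
    N i * 2 ^ Suc (d i) + 2 ^ Suc (d i) * 2 ^ L i \<le> Suc c * 2 ^ L i \<and>
    Suc c * 2 ^ L i < N i * 2 ^ Suc (d i) + 2 ^ Suc (d i) * 2 ^ L i + 2 ^ L i" for c i
  have Q: "Q (string_code \<sigma>) i \<longleftrightarrow> active i \<and> length \<sigma> = Suc (d i) \<and> a i \<le> left_endpoint \<sigma> \<and>
    left_endpoint \<sigma> < a i + (1/2) ^ Suc (d i)" for \<sigma> i
  proof -
    let ?c = "real (Suc (string_code \<sigma>))" and ?l = "2 ^ Suc (d i) :: real" and ?L = "2 ^ L i :: real"
    have "N i * 2 ^ Suc (d i) + 2 ^ Suc (d i) * 2 ^ L i \<le> Suc (string_code \<sigma>) * 2 ^ L i \<longleftrightarrow>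
        real (N i * 2 ^ Suc (d i) + 2 ^ Suc (d i) * 2 ^ L i) \<le> real (Suc (string_code \<sigma>) * 2 ^ L i)"
      by (rule of_nat_le_iff[symmetric])
    also have "\<dots> \<longleftrightarrow> (a i * ?l + ?l) * ?L \<le> ?c * ?L"
      by (simp only: of_nat_add of_nat_mult of_nat_power of_nat_numeral N) (simp add: algebra_simps)
    also have "\<dots> \<longleftrightarrow> a i * ?l + ?l \<le> ?c" by (intro mult_le_cancel_right_pos) simp
    also have "\<dots> \<longleftrightarrow> a i \<le> ?c / ?l - 1" by (simp add: field_simps)
    finally have 1: "N i * 2 ^ Suc (d i) + 2 ^ Suc (d i) * 2 ^ L i \<le> Suc (string_code \<sigma>) * 2 ^ L i \<longleftrightarrow>
      a i \<le> ?c / ?l - 1" .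
    have "Suc (string_code \<sigma>) * 2 ^ L i < N i * 2 ^ Suc (d i) + 2 ^ Suc (d i) * 2 ^ L i + 2 ^ L i \<longleftrightarrow>
        real (Suc (string_code \<sigma>) * 2 ^ L i) < real (N i * 2 ^ Suc (d i) + 2 ^ Suc (d i) * 2 ^ L i + 2 ^ L i)"
      by (rule of_nat_less_iff[symmetric])
    also have "\<dots> \<longleftrightarrow> ?c * ?L < (a i * ?l + ?l + 1) * ?L"
      by (simp only: of_nat_add of_nat_mult of_nat_power of_nat_numeral N) (simp add: algebra_simps)
    also have "\<dots> \<longleftrightarrow> ?c < a i * ?l + ?l + 1" by (intro mult_less_cancel_right_pos) simp
    also have "\<dots> \<longleftrightarrow> ?c / ?l - 1 < a i + 1 / ?l"
    proof -
      have "x < y * l + l + 1 \<longleftrightarrow> x / l - 1 < y + 1 / l" if "0 < l" for x y l :: real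
      proof -
        have "x / l - 1 < y + 1 / l \<longleftrightarrow> x / l < y + 1 + 1 / l" by linarith
        also have "\<dots> \<longleftrightarrow> x < (y + 1 + 1 / l) * l" using that by (rule pos_divide_less_eq)
        also have "(y + 1 + 1 / l) * l = y * l + l + 1" using that by (simp add: distrib_right)
        finally show ?thesis ..
      qed
      then show ?thesis by simp
    qed
    finally have 2: "Suc (string_code \<sigma>) * 2 ^ L i < N i * 2 ^ Suc (d i) + 2 ^ Suc (d i) * 2 ^ L i + 2 ^ L i \<longleftrightarrow>
      ?c / ?l - 1 < a i + 1 / ?l" .
    have "left_endpoint \<sigma> = ?c / ?l - 1" if "length \<sigma> = Suc (d i)"
      using that by (simp add: left_endpoint_def add.commute)
    then show ?thesis
      unfolding Q_def 1 2 str_of_code power_one_over by (metis (no_types))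
  qed
  have a_mono: "a i + (1/2) ^ d i \<le> a j" if "active i" "i < j" for i j
  proof -
    have "a i + (1/2) ^ d i = a (Suc i)" using that by (simp add: a_def)
    also have "\<dots> \<le> a j" unfolding a_def using that by (intro sum_mono2) auto
    finally show ?thesis .
  qed
  \<comment> \<open>A codeword interval starts in the first half of its request's interval and has
    half its length, so it stays inside. Comparable codewords have nested intervals, whereas
    distinct requests own disjoint ones.\<close>
  have inj: "i = j" if "Q (string_code \<sigma>) i" "Q (string_code \<tau>) j" "prefix \<sigma> \<tau>" for \<sigma> \<tau> i j
  proof (rule ccontr)
    assume "i \<noteq> j"
    note ends = left_endpoint_prefix[OF that(3)]
    have pos: "(0::real) < (1/2) ^ k" for k :: nat by simp
    have half: "(1/2::real) ^ k = 2 * (1/2) ^ Suc k" for k :: nat by simp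
    have i: "active i" "length \<sigma> = Suc (d i)" "a i \<le> left_endpoint \<sigma>" "left_endpoint \<sigma> < a i + (1/2) ^ Suc (d i)"
      and j: "active j" "length \<tau> = Suc (d j)" "a j \<le> left_endpoint \<tau>" "left_endpoint \<tau> < a j + (1/2) ^ Suc (d j)"
      using that(1,2) unfolding Q by blast+
    consider "i < j" | "j < i" using \<open>i \<noteq> j\<close> by linarith
    then show False
    proof cases
      case 1
      then show False
        using a_mono[OF i(1) 1] ends(2)[unfolded i(2) j(2)] i(4) j(3) pos[of "Suc (d j)"] half[of "d i"]
        by linarith
    next
      case 2
      then show False
        using a_mono[OF j(1) 2] ends(1) i(3) j(4) pos[of "Suc (d j)"] half[of "d j"] by linarith
    qed
  qed
  have ex: "\<exists>\<tau>. Q (string_code \<tau>) i" if "active i" for i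
  proof -
    let ?l = "Suc (d i)"
    \<comment> \<open>\<open>a i\<close> is rounded up to a multiple of the codeword's length.
      Kraft's inequality leaves room for two such lengths after \<open>a i\<close>, so
      \<open>k\<close> is still a valid numerator.\<close>
    define k where "k = nat \<lceil>a i * 2 ^ ?l\<rceil>"
    have "0 \<le> a i" unfolding a_def by (intro sum_nonneg) auto
    then have k: "a i * 2 ^ ?l \<le> real k" "real k < a i * 2 ^ ?l + 1"
      unfolding k_def by (simp_all add: of_nat_nat) linarith+
    have "a i + (1/2) ^ d i \<le> 1"
      using kraft[of "Suc i"] that by (simp add: a_def)
    then have "(a i + (1/2) ^ d i) * 2 ^ ?l \<le> 1 * 2 ^ ?l" by (intro mult_right_mono) auto
    then have "a i * 2 ^ ?l + 2 \<le> 2 ^ ?l" by (simp add: power_divide algebra_simps)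
    with k have "real k < real (2 ^ ?l)" by simp
    then have "k < 2 ^ ?l" by (simp only: of_nat_less_iff)
    \<comment> \<open>The string of length \<open>?l\<close> with binary value \<open>k\<close>: the
      codes of that length start at \<open>2 ^ ?l - 1\<close>.\<close>
    define \<tau> where "\<tau> = str_of (k + 2 ^ ?l - 1)"
    have code: "string_code \<tau> + 1 = k + 2 ^ ?l" by (simp add: \<tau>_def)
    have len: "length \<tau> = ?l"
      by (rule length_eqI) (use code \<open>k < 2 ^ ?l\<close> in simp_all)
    have "real (string_code \<tau>) + 1 = real k + 2 ^ ?l"
      using arg_cong[OF code, of real] by simp
    then have left: "left_endpoint \<tau> = real k / 2 ^ ?l"
      by (simp add: left_endpoint_def len field_simps)
    have pos: "(0 :: real) < 2 ^ ?l" by simp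
    have "a i \<le> left_endpoint \<tau>"
      unfolding left pos_le_divide_eq[OF pos] by (rule k(1))
    moreover have "(a i + (1/2) ^ ?l) * 2 ^ ?l = a i * 2 ^ ?l + 1"
      by (simp only: distrib_right power_mult_distrib[symmetric]) simp
    with k(2) have "left_endpoint \<tau> < a i + (1/2) ^ ?l"
      unfolding left pos_divide_less_eq[OF pos] by (simp only:)
    moreover note that len
    ultimately show ?thesis unfolding Q by blast
  qed
  \<comment> \<open>By \<open>inj\<close> at most one request fits a codeword; the
    \<open>LEAST\<close> serves to find it by search.\<close>
  define M where "M \<tau> = (if \<exists>i. Q (string_code \<tau>) i then Some (str_of (out (LEAST i. Q (string_code \<tau>) i))) else None)" for \<tau>
  have M: "M \<tau> = Some (str_of (out i))" if "Q (string_code \<tau>) i" for \<tau> i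
  proof -
    have "Q (string_code \<tau>) (LEAST i. Q (string_code \<tau>) i)" using that by (rule LeastI)
    from inj[OF this that] that show ?thesis unfolding M_def by auto
  qed
  have dom: "\<exists>i. Q (string_code \<tau>) i" if "\<tau> \<in> dom M" for \<tau>
    using that unfolding M_def by (auto split: if_splits)
  have L_rec: "recf A L"
    unfolding L_def by (intro rec_intros recf_comp[OF rec(2)])
  have N_rec: "recf A N"
    unfolding N_def
    by (intro rec_intros recf_comp[OF rec(2)] recp_comp[OF rec(1)] recf_comp[OF L_rec])
  have "recp A (\<lambda>e. Q (pfst e) (psnd e))"
    unfolding Q_def
    by (intro rec_intros recf_comp[OF rec(2)] recp_comp[OF rec(1)] recf_comp[OF L_rec] recf_comp[OF N_rec])
  from partrec_Least[OF this] have "partrec A (\<lambda>c. Option.bind (if \<exists>i. Q c i then Some (LEAST i. Q c i) else None) (\<lambda>i. Some (out i)))"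
    using rec(3) by (intro partrec.comp) (simp_all add: recf_def)
  moreover have "(if \<exists>i. Q (string_code \<tau>) i then Some (LEAST i. Q (string_code \<tau>) i) else None) \<bind> (\<lambda>i. Some (out i))
      = map_option string_code (M \<tau>)" for \<tau>
    by (simp add: M_def)
  moreover have "\<sigma> = \<tau>" if "\<sigma> \<in> dom M" "\<tau> \<in> dom M" "prefix \<sigma> \<tau>" for \<sigma> \<tau>
  proof -
    from dom[OF that(1)] dom[OF that(2)]
    obtain i j where ij: "Q (string_code \<sigma>) i" "Q (string_code \<tau>) j" by blast
    from inj[OF ij that(3)] ij have "length \<sigma> = length \<tau>" unfolding Q by simp
    with that(3) show ?thesis by (auto simp: prefix_def)
  qed
  ultimately have "prefix_free_machine A M"
    unfolding prefix_free_machine_def by blast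
  moreover have "\<exists>\<tau>. M \<tau> = Some (str_of (out i)) \<and> length \<tau> = Suc (d i)" if i: "active i" for i
  proof -
    obtain \<tau> where "Q (string_code \<tau>) i" using ex[OF i] by blast
    with M[OF this] show ?thesis unfolding Q by blast
  qed
  ultimately show thesis by (rule that)
qed

subsection \<open>Incompressibility and randomness\<close>

context homogeneous_class
begin

text \<open>Suppose a test captures \<open>X\<close>. For each \<open>n\<close>, every string
  \<open>\<sigma>\<close> of a disjoint cover of component \<open>m n\<close> within the tree
  requests a description \<open>n\<close> bits shorter than its number of branching nodes. The
  requests for all \<open>n\<close> together satisfy Kraft's inequality, and the resulting machine
  compresses initial segments of \<open>X\<close> by arbitrarily many bits, against optimality of
  \<open>U\<close>.\<close>

lemma incompressible_imp_globally_random: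
  assumes X: "X \<in> P" "incompressible U P X" and U: "optimal_prefix_free_machine (tree_oracle P) U"
  shows "globally_random P X"
proof -
  let ?A = "tree_oracle P" and ?N = "limiting_measure P"
  have "X \<notin> (\<Inter>n. \<U> n)" if test: "uniformly_ce_open ?A \<U>" and small: "\<forall>n. emeasure ?N (\<U> n) \<le> ennreal ((1/2) ^ n)" for \<U>
  proof
    assume XU: "X \<in> (\<Inter>n. \<U> n)"
    obtain p where p: "recp ?A (\<lambda>e. p (pfst (pfst e)) (psnd (pfst e)) (psnd e))"
      and \<U>: "\<And>n. \<U> n = open_of {\<sigma>. \<exists>s. p n (string_code \<sigma>) s}"
      and p_mono: "\<And>n x s t. p n x s \<Longrightarrow> s \<le> t \<Longrightarrow> p n x t"
      by (rule uniformly_ce_openE[OF test]) (rule that)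

    text \<open>
      A string enters \<open>W n\<close> once a prefix of it has been enumerated by stage its length. So \<open>W n\<close> is
      decidable and closed under extensions, and its minimal strings \<open>D n\<close> form a decidable
      prefix-free set generating \<open>\<U> n\<close>.
    \<close>
    define W where "W n \<sigma> \<longleftrightarrow> (\<exists>k<Suc (length \<sigma>). p n (string_code (take k \<sigma>)) (length \<sigma>))" for n \<sigma>
    define D where "D n \<sigma> \<longleftrightarrow> \<sigma> \<in> tree_of P \<and> W n \<sigma> \<and> (\<forall>k<length \<sigma>. \<not> W n (take k \<sigma>))" for n \<sigma>
    have D_sub: "cylinder \<sigma> \<subseteq> \<U> n" if "D n \<sigma>" for n \<sigma>
    proof -
      obtain k where k: "p n (string_code (take k \<sigma>)) (length \<sigma>)" using \<open>D n \<sigma>\<close> unfolding D_def W_def by blast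
      then have "cylinder (take k \<sigma>) \<subseteq> \<U> n" unfolding \<U> open_of_def by blast
      with cylinder_antimono[OF take_is_prefix] show ?thesis by blast
    qed
    have D_prefix: "\<sigma> = \<tau>" if "D n \<sigma>" "D n \<tau>" "prefix \<sigma> \<tau>" for n \<sigma> \<tau>
    proof -
      have eq: "\<sigma> = take (length \<sigma>) \<tau>" using \<open>prefix \<sigma> \<tau>\<close> by (auto simp: prefix_def)
      have "W n (take (length \<sigma>) \<tau>)" using \<open>D n \<sigma>\<close> eq unfolding D_def by simp
      then have "\<not> length \<sigma> < length \<tau>" using \<open>D n \<tau>\<close> unfolding D_def by blast
      with eq show ?thesis by simp
    qed

    \<comment> \<open>The summand \<open>c\<close> pays for the factor \<open>2 ^ c\<close>, one
      \<open>n\<close> for the shortened descriptions, and the remaining \<open>n + 1\<close> makes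
      the weights sum to at most 1 over all \<open>n\<close>.\<close>
    define m where "m n = 2 * n + 1 + c" for n
    \<comment> \<open>A request \<open>i\<close> codes a pair of a component index \<open>n\<close>
      and the code of a string.\<close>
    define active where "active i \<longleftrightarrow> D (m (pfst i)) (str_of (psnd i))" for i
    define d where "d i = length (branch_bits P (str_of (psnd i))) - pfst i" for i

    have sum_D: "(\<Sum>i\<in>I. weight (str_of (psnd i))) \<le> (1/2) ^ (2 * n + 1)"
      if I: "finite I" "\<And>i. i \<in> I \<Longrightarrow> active i \<and> pfst i = n" for I n
    proof -
      let ?C = "\<lambda>i. cylinder (str_of (psnd i))"
      have D: "D (m n) (str_of (psnd i))" if "i \<in> I" for i
        using I(2)[OF that] unfolding active_def by auto
      have disj: "disjoint_family_on ?C I"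
        unfolding disjoint_family_on_def
      proof (intro ballI impI, rule ccontr)
        fix i j assume i: "i \<in> I" and j: "j \<in> I" and ne: "i \<noteq> j" and "?C i \<inter> ?C j \<noteq> {}"
        then obtain Y where "Y \<in> ?C i" "Y \<in> ?C j" by blast
        then have "prefix (str_of (psnd i)) (str_of (psnd j)) \<or> prefix (str_of (psnd j)) (str_of (psnd i))"
          by (rule cylinder_comparable)
        then have "str_of (psnd i) = str_of (psnd j)"
          using D_prefix[OF D[OF i] D[OF j]] D_prefix[OF D[OF j] D[OF i]] by (elim disjE) (assumption | rule sym | simp)+
        then have "psnd i = psnd j" using code_str_of by metis
        moreover have "pfst i = pfst j" using I(2)[OF i] I(2)[OF j] by simp
        ultimately have "i = j" using prod_encode_pfst_psnd by metis
        with ne show False ..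
      qed
      have "ennreal (\<Sum>i\<in>I. weight (str_of (psnd i))) = (\<Sum>i\<in>I. ennreal (weight (str_of (psnd i))))"
        by (rule sum_ennreal[symmetric]) simp
      also have "\<dots> \<le> (\<Sum>i\<in>I. ennreal (2 ^ c) * emeasure ?N (?C i))"
      proof (rule sum_mono)
        fix i assume "i \<in> I"
        then have "str_of (psnd i) \<in> tree_of P" using D unfolding D_def by blast
        from le_limiting_measure[OF this] show "ennreal (weight (str_of (psnd i))) \<le> ennreal (2 ^ c) * emeasure ?N (?C i)"
          unfolding emeasure_cantor_lebesgue_cylinder .
      qed
      also have "\<dots> = ennreal (2 ^ c) * emeasure ?N (\<Union>i\<in>I. ?C i)"
        unfolding sum_distrib_left[symmetric] using I(1) disj by (subst sum_emeasure) auto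
      also have "\<dots> \<le> ennreal (2 ^ c) * emeasure ?N (\<U> (m n))"
      proof (intro mult_left_mono emeasure_mono)
        show "(\<Union>i\<in>I. ?C i) \<subseteq> \<U> (m n)" using D D_sub by blast
        show "\<U> (m n) \<in> sets ?N" unfolding \<U> by (rule sets_open_of) simp
      qed simp
      finally have "ennreal (\<Sum>i\<in>I. weight (str_of (psnd i))) \<le> ennreal ((1/2) ^ (2 * n + 1))"
        by (rule test_shift) (use small in \<open>simp only: m_def\<close>)
      then show ?thesis by (subst (asm) ennreal_le_iff) simp_all
    qed
    \<comment> \<open>A single cylinder of the cover already has weight at most that of the whole,
      which forces many branching nodes; hence the truncated subtraction in \<open>d\<close> is
      exact for active requests.\<close>
    have long: "2 * pfst i + 1 \<le> length (branch_bits P (str_of (psnd i)))" if "active i" for i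
    proof -
      have "(\<Sum>j\<in>{i}. weight (str_of (psnd j))) \<le> (1/2) ^ (2 * pfst i + 1)"
        by (rule sum_D) (use that in simp_all)
      then have "weight (str_of (psnd i)) \<le> (1/2) ^ (2 * pfst i + 1)" by simp
      then show ?thesis by (subst (asm) power_decreasing_iff) simp_all
    qed
    have request: "(1/2) ^ d i = 2 ^ pfst i * weight (str_of (psnd i))" if "active i" for i
    proof -
      let ?b = "length (branch_bits P (str_of (psnd i)))"
      have "(2::real) ^ pfst i * (1/2) ^ ?b = 2 ^ pfst i * (1/2) ^ (pfst i + d i)"
        using long[OF that] by (simp add: d_def)
      also have "\<dots> = (1/2) ^ d i" by (simp add: power_add power_divide)
      finally show ?thesis by simp
    qed
    have kraft: "(\<Sum>i<K. if active i then (1/2) ^ d i else 0) \<le> (1 :: real)" for K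
    proof -
      let ?I = "{i \<in> {..<K}. active i}"
      have "(\<Sum>i<K. if active i then (1/2) ^ d i else 0) = (\<Sum>i\<in>?I. (1/2 :: real) ^ d i)"
        by (rule sum.inter_filter[symmetric]) simp
      also have "\<dots> = (\<Sum>n<K. \<Sum>i\<in>{i \<in> ?I. pfst i = n}. (1/2) ^ d i)"
      proof (rule sum.group[symmetric])
        have "pfst i \<le> i" for i
          using le_prod_encode_1[of "pfst i" "psnd i"] by simp
        then show "pfst ` ?I \<subseteq> {..<K}" by (auto intro: le_less_trans)
      qed simp_all
      also have "\<dots> \<le> (\<Sum>n<K. (1/2) ^ Suc n)"
      proof (rule sum_mono)
        fix n
        let ?J = "{i \<in> ?I. pfst i = n}"
        have "(\<Sum>i\<in>?J. (1/2 :: real) ^ d i) = (\<Sum>i\<in>?J. 2 ^ n * weight (str_of (psnd i)))"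
          by (rule sum.cong) (auto simp: request)
        also have "\<dots> = 2 ^ n * (\<Sum>i\<in>?J. weight (str_of (psnd i)))"
          by (rule sum_distrib_left[symmetric])
        also have "\<dots> \<le> 2 ^ n * (1/2) ^ (2 * n + 1)"
          by (intro mult_left_mono sum_D) auto
        also have "2 * n + 1 = n + Suc n" by simp
        also have "2 ^ n * (1/2 :: real) ^ (n + Suc n) = (1/2) ^ Suc n"
          by (simp only: power_add power_divide) simp
        finally show "(\<Sum>i\<in>?J. (1/2) ^ d i) \<le> (1/2 :: real) ^ Suc n" .
      qed
      also have "\<dots> = 1 - (1/2) ^ K"
        by (induction K) simp_all
      also have "\<dots> \<le> 1" by simp
      finally show ?thesis .
    qed

    have D_rec: "recp ?A (\<lambda>e. D (pfst e) (str_of (psnd e)))"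
    proof -
      have W: "recp ?A (\<lambda>x. W (f x) (str_of (g x)))" if f: "recf ?A f" and g: "recf ?A g" for f g
        unfolding W_def
        by (intro rec_intros recp_ternary[OF p] recf_comp[OF f] recf_comp[OF g] f g)
      have D_code: "D n \<sigma> \<longleftrightarrow> \<sigma> \<in> tree_of P \<and> W n \<sigma> \<and>
          (\<forall>k<length \<sigma>. \<not> W n (str_of (string_code (take k \<sigma>))))" for n \<sigma>
        by (simp add: D_def)
      show ?thesis unfolding D_code by (intro rec_intros W)
    qed
    have active_rec: "recp ?A active"
    proof -
      have "recf ?A (\<lambda>i. prod_encode (m (pfst i), psnd i))"
        unfolding m_def by (intro rec_intros)
      from recp_comp[OF D_rec this] show ?thesis unfolding active_def by simp
    qed
    have d_rec: "recf ?A d" unfolding d_def by (intro rec_intros)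
    have out_rec: "recf ?A psnd" by (intro rec_intros)
    obtain M where M: "prefix_free_machine ?A M"
      "\<And>i. active i \<Longrightarrow> \<exists>\<tau>. M \<tau> = Some (str_of (psnd i)) \<and> length \<tau> = Suc (d i)"
      by (rule kraft_chaitin[OF active_rec d_rec out_rec kraft]) (rule that)
    obtain e where e: "\<And>\<sigma>. machine_complexity U \<sigma> \<le> machine_complexity M \<sigma> + enat e"
      using U M(1) unfolding optimal_prefix_free_machine_def by blast
    obtain r where r: "\<And>n. ereal (log 2 (real (card (level P n))) - r) \<le> ereal_of_enat (machine_complexity U (initial X n))"
      using X(2) unfolding incompressible_def by auto

    \<comment> \<open>The constants to be beaten: \<open>r\<close> from incompressibility,
      \<open>c\<close> from the level size, 1 from the extra bit of a codeword, and \<open>e\<close>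
      from optimality.\<close>
    obtain n where n: "real n > r + c + 1 + e" using reals_Archimedean2 by blast
    have "X \<in> \<U> (m n)" using XU by blast
    then obtain \<sigma> s where \<sigma>: "p (m n) (string_code \<sigma>) s" "X \<in> cylinder \<sigma>" unfolding \<U> in_open_of by blast
    \<comment> \<open>At this length the initial segment of \<open>X\<close> contains the enumerated
      string \<open>\<sigma>\<close>, and its stage of enumeration has passed.\<close>
    define l where "l = max (length \<sigma>) s"
    have "take (length \<sigma>) (initial X l) = \<sigma>"
      using \<sigma>(2) take_initial[of "length \<sigma>" l X] by (simp add: in_cylinder l_def)
    moreover have "p (m n) (string_code \<sigma>) l" using p_mono[OF \<sigma>(1)] by (simp add: l_def)
    ultimately have "W (m n) (initial X l)"
      unfolding W_def by (intro exI[of _ "length \<sigma>"]) (simp add: l_def)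
    define k where "k = (LEAST k. W (m n) (initial X k))"
    have "W (m n) (initial X k)" unfolding k_def by (rule LeastI) fact
    moreover have "\<not> W (m n) (initial X j)" if "j < k" for j
      using that not_less_Least unfolding k_def by blast
    ultimately have "D (m n) (initial X k)"
      unfolding D_def using initial_in_tree_of[OF X(1)] by (simp add: take_initial)
    then have act: "active (prod_encode (n, string_code (initial X k)))"
      unfolding active_def by simp
    from M(2)[OF act] obtain \<tau> where \<tau>: "M \<tau> = Some (initial X k)"
      "length \<tau> = Suc (length (branch_bits P (initial X k)) - n)"
      by (auto simp: d_def)
    have "machine_complexity U (initial X k) \<le> enat (length \<tau>) + enat e"
      using e[of "initial X k"] machine_complexity_le[of M \<tau>, OF \<tau>(1)] by (meson add_right_mono order_trans)
    then have "ereal_of_enat (machine_complexity U (initial X k)) \<le> ereal_of_enat (enat (length \<tau> + e))"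
      by (simp only: ereal_of_enat_le_iff plus_enat_simps)
    with r[of k] have "ereal (log 2 (real (card (level P k))) - r) \<le> ereal_of_enat (enat (length \<tau> + e))"
      by (rule order_trans)
    then have "log 2 (real (card (level P k))) - r \<le> length \<tau> + e" by simp
    moreover have "initial X k \<in> level P k"
      using initial_in_tree_of[OF X(1)] by (simp add: level_def)
    note log_card_level_bounds(2)[OF this]
    moreover have "2 * n + 1 \<le> length (branch_bits P (initial X k))" using long[OF act] by simp
    ultimately show False using n \<tau>(2) by simp
  qed
  then show ?thesis unfolding globally_random_def MLR_def by blast
qed

end

theorem theorem6p23:
  fixes P :: "cantor set" and X :: cantor and U :: "str \<rightharpoonup> str"
  assumes "P \<noteq> {}"
    and "Pi01_class P"
    and "additively_homogeneous P"
    and "\<forall>\<sigma>\<in>tree_of P. convergent (relative_measure P \<sigma>)"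
    and "optimal_prefix_free_machine (tree_oracle P) U"
    and "X \<in> P"
  shows "(randomly_produced P X \<longleftrightarrow> incompressible U P X) \<and>
    (incompressible U P X \<longleftrightarrow> globally_random P X)"
proof -
  obtain c where "homogeneous_class P c"
    using homogeneous_classI[OF assms(1,3,4)] .
  then interpret homogeneous_class P c .
  have "prefix_free_machine (tree_oracle P) U"
    using assms(5) unfolding optimal_prefix_free_machine_def by (rule conjunct1)
  then show ?thesis
    using randomly_produced_imp_globally_random globally_random_imp_randomly_produced[OF assms(6)]
      globally_random_imp_incompressible[OF assms(6)] incompressible_imp_globally_random[OF assms(6) _ assms(5)]
    by blast
qed

end
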